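(* Let $q$ be a prime power with $q\equiv 3\pmod 4$. The double Paley $\mathrm{ETF}(2q+2,q+1)$ is a genuine projective dihedral frame for the dihedral group $\Delta\cong D_{q+1}$ (of order $2(q+1)$), through the projective representation $D\Pi|_{\Delta}$: that is, $D\Pi(g)\,DH_q\,D\Pi(g)^*=DH_q$ for $g\in\Delta$, the double Paley ETF is switching equivalent to a configuration $(\pi(g)v)_{g\in\Delta}$ of a unit vector $v\in\mathbb{C}^{q+1}$ under a projective unitary representation $\pi$ of $\Delta$ arising from these automorphisms, and $D\Pi|_\Delta$ is not equivalent to a strict representation.
   Context: $\mathbb{P}^1_q$ is the projective line over $\mathbb F_q$; for each $P$ fix a representative $\hat P\in\mathbb F_q^2\setminus\{0\}$. Let $\chi(a)=1$ if $a\in\mathbb F_q$ is a square (including $0$) and $-1$ otherwise. $H_q=(\chi(\det(\hat P,\hat Q)))_{P,Q\in\mathbb{P}^1_q}$ is the Paley skew Hadamard matrix of order $q+1$, and $DH_q=[H_q,H_q;-H_q^\top,H_q^\top]$ is skew Hadamard of order $2q+2$. The double Paley ETF is a family of $2q+2$ unit vectors in $\mathbb{C}^{q+1}$ with Gram matrix $I+\frac{1}{\sqrt{2q+1}}\begin{bmatrix}\mathrm{i}(H_q-I)&H_q\\H_q^\top&\mathrm{i}(H_q^\top-I)\end{bmatrix}$ (defined up to switching equivalence: $\Psi=Q\Phi\Pi^*$, $Q$ unitary, $\Pi$ phase monomial). $PGL(2,q)$ acts on $\mathbb{P}^1_q$ by $g[u:v]=[au+bv:cu+dv]$ for $g$ the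 class of $[a,b;c,d]$; $PSL(2,q)$ is the subgroup of classes of determinant-one matrices. For $g\in PGL(2,q)$ fix a lift $\hat g\in GL(2,q)$ and define $\lambda(g,P)\in\mathbb F_q^\times$ by $\lambda(g,P)\hat g\hat P=\widehat{gP}$; let $\Pi(g)$ be the $(q+1)\times(q+1)$ monomial matrix with $\Pi(g)_{gP,P}=\chi(\lambda(g,P))$ and other entries $0$. Define $D\Pi(g)=[\Pi(g),0;0,\Pi(g)]$ for $g\in PSL(2,q)$ and $D\Pi(g)=[0,-\Pi(g);\Pi(g),0]$ otherwise. Let $\mathbb F_{q^2}=\mathbb F_q(\sqrt{-1})$, let $a+b\sqrt{-1}$ generate $\mathbb F_{q^2}^\times$, let $m_1\in PGL(2,q)$ be the class of $[a,b;-b,a]$ (order $q+1$) and $t_1$ the class of $[\alpha,\beta;\beta,-\alpha]$ where $\alpha^2+\beta^2=-1$; $\Delta=\langle m_1,t_1\rangle\cong D_{q+1}$. A projective unitary representation satisfies $\pi(gg')=c\,\pi(g)\pi(g')$ with $|c|=1$; it is strict if a homomorphism, and two are equivalent if conjugate by a fixed unitary up to unimodular scalars. A genuine projective dihedral frame is one generated by a projective representation of a dihedral group not equivalent to a strict one. *)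

theory Defs
  imports
    "HOL-Analysis.Analysis"
    "HOL-Algebra.Coset"
    "HOL-Algebra.Generated_Groups"
    "HOL-Algebra.Multiplicative_Group"
begin

section \<open>Complex matrices\<close>

definition adj :: "complex ^ 'n ^ 'm \<Rightarrow> complex ^ 'm ^ 'n" where
  "adj A = (\<chi> i j. cnj (A $ j $ i))"

definition cscale :: "complex \<Rightarrow> complex ^ 'n ^ 'm \<Rightarrow> complex ^ 'n ^ 'm" where
  "cscale c A = (\<chi> i j. c * A $ i $ j)"

definition unitary :: "complex ^ 'n ^ 'n \<Rightarrow> bool" where
  "unitary U \<longleftrightarrow> U ** adj U = mat 1 \<and> adj U ** U = mat 1"

definition phase_monomial :: "complex ^ 'n ^ 'n \<Rightarrow> bool" where
  "phase_monomial M \<longleftrightarrow> (\<exists>\<sigma> c. bij \<sigma> \<and> (\<forall>j. cmod (c j) = 1) \<and>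
     M = (\<chi> i j. if i = \<sigma> j then c j else 0))"

definition block_mat ::
  "complex ^ 'n ^ 'm \<Rightarrow> complex ^ 'p ^ 'm \<Rightarrow> complex ^ 'n ^ 'r \<Rightarrow> complex ^ 'p ^ 'r
    \<Rightarrow> complex ^ ('n + 'p) ^ ('m + 'r)" where
  "block_mat A B C D = (\<chi> i j. case i of
      Inl i' \<Rightarrow> (case j of Inl j' \<Rightarrow> A $ i' $ j' | Inr j' \<Rightarrow> B $ i' $ j')
    | Inr i' \<Rightarrow> (case j of Inl j' \<Rightarrow> C $ i' $ j' | Inr j' \<Rightarrow> D $ i' $ j'))"


section \<open>Families of vectors\<close>

text \<open>
  A family of vectors in \<open>\<complex>\<^sup>d\<close> is given by its synthesis matrix, whose columns are the vectors;
  its Gram matrix is \<open>adj \<Phi> ** \<Phi>\<close>.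
\<close>

definition switching_equivalent :: "complex ^ 'n ^ 'd \<Rightarrow> complex ^ 'n ^ 'd \<Rightarrow> bool" where
  "switching_equivalent \<Psi> \<Phi> \<longleftrightarrow>
     (\<exists>Q P. unitary Q \<and> phase_monomial P \<and> \<Psi> = Q ** \<Phi> ** adj P)"

definition is_ETF :: "nat \<Rightarrow> nat \<Rightarrow> complex ^ 'n ^ 'd \<Rightarrow> bool" where
  "is_ETF n d \<Phi> \<longleftrightarrow> CARD('n) = n \<and> CARD('d) = d
     \<and> (\<forall>i. norm (column i \<Phi>) = 1)
     \<and> (\<exists>\<mu>. \<forall>i j. i \<noteq> j \<longrightarrow> cmod ((adj \<Phi> ** \<Phi>) $ i $ j) = \<mu>)
     \<and> (\<exists>c::real. \<Phi> ** adj \<Phi> = mat (complex_of_real c))"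

text \<open>The Gram matrix \<open>I + i / sqrt (n - 1) (S - I)\<close> attached to a skew Hadamard matrix of order n.\<close>

definition skew_hadamard_gram :: "complex ^ 'n ^ 'n \<Rightarrow> complex ^ 'n ^ 'n" where
  "skew_hadamard_gram S =
     mat 1 + cscale (\<i> / complex_of_real (sqrt (real CARD('n) - 1))) (S - mat 1)"


section \<open>Projective unitary representations\<close>

definition projective_unitary_rep ::
  "('g, 'b) monoid_scheme \<Rightarrow> ('g \<Rightarrow> complex ^ 'n ^ 'n) \<Rightarrow> bool" where
  "projective_unitary_rep G \<pi> \<longleftrightarrow> (\<forall>g\<in>carrier G. unitary (\<pi> g)) \<and>
     (\<forall>g\<in>carrier G. \<forall>h\<in>carrier G. \<exists>c. cmod c = 1 \<and> \<pi> (g \<otimes>\<^bsub>G\<^esub> h) = cscale c (\<pi> g ** \<pi> h))"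

definition strict_unitary_rep ::
  "('g, 'b) monoid_scheme \<Rightarrow> ('g \<Rightarrow> complex ^ 'n ^ 'n) \<Rightarrow> bool" where
  "strict_unitary_rep G \<pi> \<longleftrightarrow> (\<forall>g\<in>carrier G. unitary (\<pi> g)) \<and>
     (\<forall>g\<in>carrier G. \<forall>h\<in>carrier G. \<pi> (g \<otimes>\<^bsub>G\<^esub> h) = \<pi> g ** \<pi> h)"

definition rep_equivalent ::
  "('g, 'b) monoid_scheme \<Rightarrow> ('g \<Rightarrow> complex ^ 'n ^ 'n) \<Rightarrow> ('g \<Rightarrow> complex ^ 'n ^ 'n) \<Rightarrow> bool" where
  "rep_equivalent G \<pi> \<rho> \<longleftrightarrow> (\<exists>U. unitary U \<and>
     (\<forall>g\<in>carrier G. \<exists>c. cmod c = 1 \<and> \<pi> g = cscale c (U ** \<rho> g ** adj U)))"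

definition genuine_rep ::
  "('g, 'b) monoid_scheme \<Rightarrow> ('g \<Rightarrow> complex ^ 'n ^ 'n) \<Rightarrow> bool" where
  "genuine_rep G \<pi> \<longleftrightarrow> projective_unitary_rep G \<pi> \<and>
     \<not> (\<exists>\<rho>. strict_unitary_rep G \<rho> \<and> rep_equivalent G \<pi> \<rho>)"

text \<open>
  The configuration \<open>(\<pi>(g) v)\<close> indexed by the group elements becomes a matrix after an enumeration
  \<open>e\<close> of the group; its choice is immaterial, since switching includes permutations of the columns.
\<close>

definition generates_frame ::
  "('g, 'b) monoid_scheme \<Rightarrow> ('g \<Rightarrow> complex ^ 'd ^ 'd) \<Rightarrow> complex ^ 'd
    \<Rightarrow> complex ^ 'n ^ 'd \<Rightarrow> bool" where
  "generates_frame G \<pi> v \<Phi> \<longleftrightarrow> (\<exists>e :: 'n \<Rightarrow> 'g. bij_betw e UNIV (carrier G) \<and>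
     switching_equivalent (\<chi> k j. (\<pi> (e j) *v v) $ k) \<Phi>)"

text \<open>The dihedral group of order \<open>2 n\<close>; the pair \<open>(i, s)\<close> stands for \<open>r\<^sup>i f\<^sup>s\<close>.\<close>

definition dihedral_group :: "nat \<Rightarrow> (int \<times> bool) monoid" where
  "dihedral_group n = \<lparr>carrier = {0..<int n} \<times> UNIV,
     monoid.mult = (\<lambda>(i, s) (j, t). ((if s then i - j else i + j) mod int n, s \<noteq> t)),
     one = (0, False)\<rparr>"

definition genuine_projective_dihedral_frame ::
  "('g, 'b) monoid_scheme \<Rightarrow> nat \<Rightarrow> ('g \<Rightarrow> complex ^ 'd ^ 'd) \<Rightarrow> complex ^ 'd
    \<Rightarrow> complex ^ 'n ^ 'd \<Rightarrow> bool" where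
  "genuine_projective_dihedral_frame G n \<pi> v \<Phi> \<longleftrightarrow>
     G \<cong> dihedral_group n \<and> genuine_rep G \<pi> \<and> norm v = 1 \<and> generates_frame G \<pi> v \<Phi>"


section \<open>The projective line and PGL(2,q)\<close>

typedef (overloaded) 'a proj_line =
  "{L :: ('a::field ^ 2) set. \<exists>x. x \<noteq> 0 \<and> L = vec.span {x}}"
  morphisms line_of Proj
  by (rule exI[of _ "vec.span {axis 1 1}"]) (auto intro!: exI[of _ "axis 1 1"] simp: axis_eq_0_iff)

instance proj_line :: ("{field, finite}") finite
proof
  have "range (line_of :: 'a proj_line \<Rightarrow> _) \<subseteq> UNIV" by simp
  then have "finite (range (line_of :: 'a proj_line \<Rightarrow> _))"
    by (rule finite_subset) simp
  then show "finite (UNIV :: 'a proj_line set)"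
    by (rule finite_imageD) (simp add: inj_on_def line_of_inject)
qed

definition GL2 :: "('a::field ^ 2 ^ 2) monoid" where
  "GL2 = \<lparr>carrier = {A. invertible A}, monoid.mult = (**), one = mat 1\<rparr>"

definition scalars2 :: "('a::field ^ 2 ^ 2) set" where
  "scalars2 = {mat c | c. c \<noteq> 0}"

definition PGL2 :: "('a::field ^ 2 ^ 2) set monoid" where
  "PGL2 = GL2 Mod scalars2"

definition pclass :: "'a::field ^ 2 ^ 2 \<Rightarrow> ('a ^ 2 ^ 2) set" where
  "pclass A = scalars2 #>\<^bsub>GL2\<^esub> A"

definition PSL2 :: "('a::field ^ 2 ^ 2) set set" where
  "PSL2 = {pclass A | A. det A = 1}"

definition mat22 :: "'a \<Rightarrow> 'a \<Rightarrow> 'a \<Rightarrow> 'a \<Rightarrow> 'a::zero ^ 2 ^ 2" where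
  "mat22 a b c d = vector [vector [a, b], vector [c, d]]"

text \<open>All matrices in the class \<open>g\<close> map the line \<open>P\<close> onto the same line.\<close>

definition pgl_act :: "('a::field ^ 2 ^ 2) set \<Rightarrow> 'a proj_line \<Rightarrow> 'a proj_line" where
  "pgl_act g P = Proj {A *v x | A x. A \<in> g \<and> x \<in> line_of P}"


section \<open>The (double) Paley matrices and their automorphisms\<close>

definition quad_char :: "'a::field \<Rightarrow> complex" where
  "quad_char a = (if \<exists>b. a = b\<^sup>2 then 1 else -1)"

definition valid_reps :: "('a::field proj_line \<Rightarrow> 'a ^ 2) \<Rightarrow> bool" where
  "valid_reps rep \<longleftrightarrow> (\<forall>P. rep P \<noteq> 0 \<and> rep P \<in> line_of P)"

definition valid_lifts :: "(('a::field ^ 2 ^ 2) set \<Rightarrow> 'a ^ 2 ^ 2) \<Rightarrow> bool" where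
  "valid_lifts lift \<longleftrightarrow> (\<forall>g\<in>carrier PGL2. lift g \<in> g)"

definition paley_H ::
  "('a::{field,finite} proj_line \<Rightarrow> 'a ^ 2) \<Rightarrow> complex ^ 'a proj_line ^ 'a proj_line" where
  "paley_H rep = (\<chi> P Q. quad_char (det (transpose (vector [rep P, rep Q]) :: 'a ^ 2 ^ 2)))"

definition paley_DH ::
  "('a::{field,finite} proj_line \<Rightarrow> 'a ^ 2)
    \<Rightarrow> complex ^ ('a proj_line + 'a proj_line) ^ ('a proj_line + 'a proj_line)" where
  "paley_DH rep = (let H = paley_H rep in block_mat H H (- transpose H) (transpose H))"

definition double_paley_ETF ::
  "('a::{field,finite} proj_line \<Rightarrow> 'a ^ 2)
    \<Rightarrow> complex ^ ('a proj_line + 'a proj_line) ^ 'd \<Rightarrow> bool" where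
  "double_paley_ETF rep \<Phi> \<longleftrightarrow> (let H = paley_H rep in
     adj \<Phi> ** \<Phi> = mat 1 + cscale (1 / complex_of_real (sqrt (2 * real CARD('a) + 1)))
       (block_mat (cscale \<i> (H - mat 1)) H
                  (transpose H) (cscale \<i> (transpose H - mat 1))))"

definition scaling_factor ::
  "('a::field proj_line \<Rightarrow> 'a ^ 2) \<Rightarrow> (('a ^ 2 ^ 2) set \<Rightarrow> 'a ^ 2 ^ 2)
    \<Rightarrow> ('a ^ 2 ^ 2) set \<Rightarrow> 'a proj_line \<Rightarrow> 'a" where
  "scaling_factor rep lift g P =
     (THE l. l \<noteq> 0 \<and> l *s (lift g *v rep P) = rep (pgl_act g P))"

definition paley_Pi ::
  "('a::{field,finite} proj_line \<Rightarrow> 'a ^ 2) \<Rightarrow> (('a ^ 2 ^ 2) set \<Rightarrow> 'a ^ 2 ^ 2)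
    \<Rightarrow> ('a ^ 2 ^ 2) set \<Rightarrow> complex ^ 'a proj_line ^ 'a proj_line" where
  "paley_Pi rep lift g =
     (\<chi> R P. if R = pgl_act g P then quad_char (scaling_factor rep lift g P) else 0)"

definition paley_DPi ::
  "('a::{field,finite} proj_line \<Rightarrow> 'a ^ 2) \<Rightarrow> (('a ^ 2 ^ 2) set \<Rightarrow> 'a ^ 2 ^ 2)
    \<Rightarrow> ('a ^ 2 ^ 2) set
    \<Rightarrow> complex ^ ('a proj_line + 'a proj_line) ^ ('a proj_line + 'a proj_line)" where
  "paley_DPi rep lift g = (let M = paley_Pi rep lift g in
     if g \<in> PSL2 then block_mat M 0 0 M else block_mat 0 (- M) M 0)"

text \<open>
  A monomial automorphism of the skew Hadamard matrix \<open>S\<close> commutes with \<open>skew_hadamard_gram S\<close>,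
  so it permutes, up to phases and a unitary, the columns of a family \<open>\<Psi>\<close> with this Gram matrix.
  The representation \<open>\<pi>\<close> consists of these unitaries. For the double Paley ETF \<open>\<Phi>\<close> the Gram
  matrix is \<open>skew_hadamard_gram S\<close>, with \<open>S\<close> the double Paley matrix, only after a switching;
  hence \<open>\<Psi>\<close>.
\<close>

definition arises_from_automorphisms ::
  "('g, 'b) monoid_scheme \<Rightarrow> complex ^ 'n ^ 'n \<Rightarrow> ('g \<Rightarrow> complex ^ 'n ^ 'n)
    \<Rightarrow> ('g \<Rightarrow> complex ^ 'd ^ 'd) \<Rightarrow> complex ^ 'n ^ 'd \<Rightarrow> bool" where
  "arises_from_automorphisms G S \<Gamma> \<pi> \<Phi> \<longleftrightarrow>
     (\<exists>\<Psi>. switching_equivalent \<Psi> \<Phi> \<and> adj \<Psi> ** \<Psi> = skew_hadamard_gram S \<and>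
        (\<forall>g\<in>carrier G. \<pi> g ** \<Psi> = \<Psi> ** \<Gamma> g))"


section \<open>The dihedral subgroup\<close>

text \<open>\<open>F\<^sub>q(sqrt (-1))\<close>; the pair \<open>(a, b)\<close> stands for \<open>a + b sqrt (-1)\<close>. It is a field iff -1 is a nonsquare.\<close>

definition adjoin_sqrt_minus_one :: "('a::field \<times> 'a) ring" where
  "adjoin_sqrt_minus_one = \<lparr>carrier = UNIV,
     monoid.mult = (\<lambda>(a, b) (c, d). (a * c - b * d, a * d + b * c)),
     one = (1, 0), zero = (0, 0),
     add = (\<lambda>(a, b) (c, d). (a + c, b + d))\<rparr>"

definition Delta_group :: "'a::field \<Rightarrow> 'a \<Rightarrow> 'a \<Rightarrow> 'a \<Rightarrow> ('a ^ 2 ^ 2) set monoid" where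
  "Delta_group a b \<alpha> \<beta> = PGL2 \<lparr>carrier :=
     generate PGL2 {pclass (mat22 a b (- b) a), pclass (mat22 \<alpha> \<beta> \<beta> (- \<alpha>))}\<rparr>"

end

theory Submission
  imports Defs
begin

text \<open>
  The monomial matrix of an element of \<open>PSL(2,q)\<close> commutes with the Paley matrix, that of any other
  element of \<open>PGL(2,q)\<close> exchanges it with its transpose; the two block shapes of the double
  representation compensate for this. The rotations in \<open>Delta\<close> are the image of the multiplicative group of
  \<open>F\<^sub>q(sqrt (-1))\<close> and act simply transitively on the projective line, because \<open>x + y sqrt (-1)\<close>
  moves the base point to \<open>[x : -y]\<close>; comparing norms with determinants, \<open>Delta\<close> acts simply
  transitively on the \<open>2 q + 2\<close> columns. So the unitaries obtained by compressing the double
  representation to the range of the Gram matrix carry one column of the frame to all others up to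
  phases. The rotation of order two commutes with the reflection, while the matrices representing them
  anticommute, which no strict representation allows.
\<close>

section \<open>Quadratic characters\<close>

text \<open>The hypothesis on q enters mostly through one fact: -1 is a nonsquare. Hence an
  alternating determinant changes its character when its arguments are exchanged, a sum of two
  squares vanishes only trivially, and the scalar -1, invisible in \<open>PGL2\<close>, acts with
  sign -1 through the monomial matrices. A double Paley family is given only by its Gram matrix, in
  a space without a preferred basis. This matrix becomes a polynomial in \<open>paley_DH\<close>
  only after half of the columns are multiplied by a phase; in that form it is the identity plus an
  involution, so it is twice a projection. Since there are twice as many vectors as dimensions, a
  trace computation makes the vectors a tight frame, and tightness makes compression multiplicative
  on the automorphisms. The sign between anticommuting matrices therefore survives compression, so
  one obstruction serves both the large monomial matrices and the unitaries on the small space. A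
  claim about all such families would be empty without an example, so one is also
  constructed.\<close>

lemma finite_field_power_card_minus_one:
  fixes x :: "'a::{field,finite}"
  assumes "x \<noteq> 0"
  shows "x ^ (CARD('a) - 1) = 1"
proof -
  let ?P = "\<Prod>y\<in>UNIV - {0::'a}. y"
  have "bij_betw (\<lambda>y. x * y) (UNIV - {0}) (UNIV - {0})"
    by (rule bij_betwI[where g = "\<lambda>y. y / x"]) (use assms in auto)
  then have "?P = (\<Prod>y\<in>UNIV - {0}. x * y)"
    by (rule prod.reindex_bij_betw[symmetric])
  also have "\<dots> = x ^ (CARD('a) - 1) * ?P"
    by (simp add: prod.distrib card_Diff_singleton)
  finally show ?thesis by simp
qed

text \<open>The exponent \<open>CARD('a) - 1\<close> is twice an odd number, so raising a square
  root of -1 to it gives -1, while Fermat gives 1. This leaves characteristic two, which an odd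
  \<open>CARD('a)\<close> excludes.\<close>

lemma minus_one_neq_square:
  fixes b :: "'a::{field,finite}"
  assumes "CARD('a) mod 4 = 3"
  shows "b\<^sup>2 \<noteq> -1"
proof
  assume b: "b\<^sup>2 = -1"
  obtain k where k: "CARD('a) = 4 * k + 3"
    using assms by (metis mult_div_mod_eq)
  have "b \<noteq> 0" using b by auto
  then have "1 = b ^ (CARD('a) - 1)"
    by (rule finite_field_power_card_minus_one[symmetric])
  also have "CARD('a) - 1 = 2 * (2 * k + 1)" using k by simp
  also have "b ^ \<dots> = -1" by (simp only: power_mult b) simp
  finally have two: "(1::'a) = -1" .
  \<comment> \<open>Translation by 1 permutes the field, so the sums agree and
    \<open>CARD('a)\<close> vanishes in the field; being odd, it would equal 1 if 2 were 0.\<close>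
  have "(\<Sum>x\<in>UNIV. x + 1) = (\<Sum>x\<in>UNIV. x :: 'a)"
    by (rule sum.reindex_bij_betw) (rule bij_betwI[where g = "\<lambda>y. y - 1"], auto)
  then have "of_nat CARD('a) = (0::'a)" by (simp add: sum.distrib)
  moreover have "of_nat CARD('a) = 2 * (2 * of_nat k + 1) + (1::'a)" by (simp add: k)
  moreover have "(2::'a) = 0" by (metis two add.right_inverse one_add_one)
  ultimately show False by simp
qed

lemma one_neq_minus_one:
  assumes "CARD('a::{field,finite}) mod 4 = 3"
  shows "(1::'a) \<noteq> -1"
  using minus_one_neq_square[OF assms, of 1] by auto

text \<open>By Fermat \<open>x ^ (2 * k + 1)\<close> is 1 or -1, the exponent being half of
  \<open>CARD('a) - 1\<close>. One more factor \<open>x\<close> makes the exponent even, so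
  \<open>x ^ (k + 1)\<close> is the root.\<close>

lemma square_or_minus_square:
  fixes x :: "'a::{field,finite}"
  assumes "CARD('a) mod 4 = 3"
  shows "\<exists>b. x = b\<^sup>2 \<or> x = - (b\<^sup>2)"
proof (cases "x = 0")
  case False
  obtain k where k: "CARD('a) = 4 * k + 3"
    using assms by (metis mult_div_mod_eq)
  have "CARD('a) - 1 = (2 * k + 1) * 2" using k by simp
  then have "(x ^ (2 * k + 1))\<^sup>2 = 1"
    using finite_field_power_card_minus_one[OF False] by (metis power_mult)
  then have "x ^ (2 * k + 1) = 1 \<or> x ^ (2 * k + 1) = -1" by (simp only: power2_eq_1_iff)
  moreover have "x * x ^ (2 * k + 1) = (x ^ (k + 1))\<^sup>2"
    by (simp add: power_mult[symmetric] power_Suc[symmetric] mult.commute del: power_Suc)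
  ultimately show ?thesis by (metis mult.right_neutral mult_minus_right minus_minus)
qed (auto intro: exI[of _ 0])

lemma quad_char_cases: "quad_char x = 1 \<or> quad_char x = -1"
  by (simp add: quad_char_def)

lemma quad_char_sq [simp]: "quad_char x * quad_char x = 1"
  by (simp add: quad_char_def)

lemma cmod_quad_char [simp]: "cmod (quad_char x) = 1"
  by (simp add: quad_char_def)

lemma cnj_quad_char [simp]: "cnj (quad_char x) = quad_char x"
  by (simp add: quad_char_def)

lemma quad_char_neq_0 [simp]: "quad_char x \<noteq> 0"
  by (simp add: quad_char_def)

lemma quad_char_0 [simp]: "quad_char 0 = 1"
  by (simp add: quad_char_def exI[of _ 0])

lemma quad_char_square: "quad_char (b\<^sup>2) = 1"
  by (auto simp add: quad_char_def)

text \<open>If \<open>x\<close> and \<open>- x\<close> were both squares, the quotient of the roots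
  would be a root of -1. At 0 the sign rule fails because the character is 1 there by convention,
  which is why the diagonal is treated separately below.\<close>

lemma quad_char_minus:
  fixes x :: "'a::{field,finite}"
  assumes "CARD('a) mod 4 = 3" and "x \<noteq> 0"
  shows "quad_char (- x) = - quad_char x"
proof -
  have "\<not> (x = b\<^sup>2 \<and> - x = c\<^sup>2)" for b c
  proof
    assume *: "x = b\<^sup>2 \<and> - x = c\<^sup>2"
    then have "b \<noteq> 0" using assms(2) by auto
    then have "(c / b)\<^sup>2 = -1" using * by (metis assms(2) divide_minus_left divide_self power_divide)
    then show False using minus_one_neq_square[OF assms(1)] by blast
  qed
  moreover have "(\<exists>b. x = b\<^sup>2) \<or> (\<exists>b. - x = b\<^sup>2)"
    using square_or_minus_square[OF assms(1), of x] by auto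
  ultimately show ?thesis unfolding quad_char_def by auto
qed

lemma quad_char_square_times:
  fixes x :: "'a::field"
  assumes "b \<noteq> 0"
  shows "quad_char (b\<^sup>2 * x) = quad_char x"
proof -
  have "(\<exists>c. b\<^sup>2 * x = c\<^sup>2) \<longleftrightarrow> (\<exists>c. x = c\<^sup>2)"
  proof
    assume "\<exists>c. b\<^sup>2 * x = c\<^sup>2"
    then obtain c where "b\<^sup>2 * x = c\<^sup>2" ..
    then have "x = (c / b)\<^sup>2" using assms by (simp add: power_divide field_simps)
    then show "\<exists>c. x = c\<^sup>2" ..
  qed (metis power_mult_distrib)
  then show ?thesis by (simp add: quad_char_def)
qed

lemma quad_char_mult:
  fixes x y :: "'a::{field,finite}"
  assumes "CARD('a) mod 4 = 3" and "x \<noteq> 0" and "y \<noteq> 0"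
  shows "quad_char (x * y) = quad_char x * quad_char y"
proof -
  obtain b where "x = b\<^sup>2 \<or> x = - (b\<^sup>2)" using square_or_minus_square[OF assms(1)] by blast
  moreover have "b \<noteq> 0" using calculation assms(2) by auto
  ultimately show ?thesis
    using quad_char_square_times[of b y] quad_char_minus[OF assms(1)] assms quad_char_square[of b]
    by auto
qed

section \<open>Matrices over the complex numbers\<close>

lemma adj_nth [simp]: "adj A $ i $ j = cnj (A $ j $ i)"
  by (simp add: adj_def)

lemma cscale_nth [simp]: "cscale c A $ i $ j = c * A $ i $ j"
  by (simp add: cscale_def)

lemma matrix_eq_iff: "A = B \<longleftrightarrow> (\<forall>i j. A $ i $ j = B $ i $ j)"
  by (simp add: vec_eq_iff)

lemma adj_adj [simp]: "adj (adj A) = A"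
  by (simp add: matrix_eq_iff)

lemma adj_mult: "adj (A ** B) = adj B ** adj A"
  by (simp add: matrix_eq_iff matrix_matrix_mult_def mult.commute)

lemma adj_cscale [simp]: "adj (cscale c A) = cscale (cnj c) (adj A)"
  by (simp add: matrix_eq_iff)

lemma adj_add: "adj (A + B) = adj A + adj B"
  by (simp add: matrix_eq_iff)

lemma adj_diff: "adj (A - B) = adj A - adj B"
  by (simp add: matrix_eq_iff)

lemma adj_uminus [simp]: "adj (- A) = - adj A"
  by (simp add: matrix_eq_iff)

lemma adj_mat_1 [simp]: "adj (mat 1) = mat 1"
  by (simp add: matrix_eq_iff mat_def)

lemma adj_0 [simp]: "adj 0 = 0"
  by (simp add: matrix_eq_iff)

lemma cscale_mult_left: "cscale c A ** B = cscale c (A ** B)"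
  by (simp add: matrix_eq_iff matrix_matrix_mult_def sum_distrib_left mult.assoc)

lemma cscale_mult_right: "A ** cscale c B = cscale c (A ** B)"
  by (simp add: matrix_eq_iff matrix_matrix_mult_def sum_distrib_left mult.left_commute)

lemma cscale_cscale [simp]: "cscale c (cscale d A) = cscale (c * d) A"
  by (simp add: matrix_eq_iff mult.assoc)

lemma cscale_1 [simp]: "cscale 1 A = A"
  by (simp add: matrix_eq_iff)

lemma cscale_add: "cscale c (A + B) = cscale c A + cscale c B"
  by (simp add: matrix_eq_iff algebra_simps)

lemma matrix_add_rdistrib: "((A :: complex ^ 'n ^ 'm) + B) ** C = A ** C + B ** C"
  by (simp add: matrix_eq_iff matrix_matrix_mult_def algebra_simps sum.distrib)

lemma matrix_minus_left: "(- (A :: complex ^ 'n ^ 'm)) ** B = - (A ** B)"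
  by (simp add: matrix_eq_iff matrix_matrix_mult_def sum_negf)

lemma matrix_minus_right: "(A :: complex ^ 'n ^ 'm) ** (- B) = - (A ** B)"
  by (simp add: matrix_eq_iff matrix_matrix_mult_def sum_negf)

lemma matrix_diff_rdistrib: "((A :: complex ^ 'n ^ 'm) - B) ** C = A ** C - B ** C"
  by (simp add: matrix_eq_iff matrix_matrix_mult_def algebra_simps sum_subtractf)

lemma matrix_diff_ldistrib: "(A :: complex ^ 'n ^ 'm) ** (B - C) = A ** B - A ** C"
  by (simp add: matrix_eq_iff matrix_matrix_mult_def algebra_simps sum_subtractf)

lemma matrix_mult_0_left [simp]: "(0 :: complex ^ 'n ^ 'm) ** A = 0"
  by (simp add: matrix_eq_iff matrix_matrix_mult_def)

lemma matrix_mult_0_right [simp]: "(A :: complex ^ 'n ^ 'm) ** 0 = 0"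
  by (simp add: matrix_eq_iff matrix_matrix_mult_def)

section \<open>Two-by-two block matrices\<close>

lemma sum_UNIV_Plus:
  fixes f :: "'n::finite + 'p::finite \<Rightarrow> 'b::comm_monoid_add"
  shows "(\<Sum>k\<in>UNIV. f k) = (\<Sum>i\<in>UNIV. f (Inl i)) + (\<Sum>j\<in>UNIV. f (Inr j))"
  by (simp add: UNIV_Plus_UNIV[symmetric] sum.Plus del: UNIV_Plus_UNIV)

lemma block_mat_nth [simp]:
  "block_mat A B C D $ Inl i $ Inl j = A $ i $ j"
  "block_mat A B C D $ Inl i $ Inr j' = B $ i $ j'"
  "block_mat A B C D $ Inr i' $ Inl j = C $ i' $ j"
  "block_mat A B C D $ Inr i' $ Inr j' = D $ i' $ j'"
  by (simp_all add: block_mat_def)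

lemma matrix_sum_eq_iff:
  "A = B \<longleftrightarrow> (\<forall>i j. A $ Inl i $ Inl j = B $ Inl i $ Inl j) \<and> (\<forall>i j. A $ Inl i $ Inr j = B $ Inl i $ Inr j)
    \<and> (\<forall>i j. A $ Inr i $ Inl j = B $ Inr i $ Inl j) \<and> (\<forall>i j. A $ Inr i $ Inr j = B $ Inr i $ Inr j)"
  by (simp add: matrix_eq_iff split_sum_all) blast

lemma block_mat_mult:
  "block_mat A B C D ** block_mat E F G K
    = block_mat (A ** E + B ** G) (A ** F + B ** K) (C ** E + D ** G) (C ** F + D ** K)"
  by (simp add: matrix_sum_eq_iff matrix_matrix_mult_def sum_UNIV_Plus)

lemma adj_block_mat: "adj (block_mat A B C D) = block_mat (adj A) (adj C) (adj B) (adj D)"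
  by (simp add: matrix_sum_eq_iff)

lemma cscale_block_mat:
  "cscale c (block_mat A B C D) = block_mat (cscale c A) (cscale c B) (cscale c C) (cscale c D)"
  by (simp add: matrix_sum_eq_iff)

lemma mat_1_block_mat: "mat 1 = block_mat (mat 1) 0 0 (mat 1)"
  by (simp add: matrix_sum_eq_iff mat_def)

lemma block_mat_add:
  "block_mat A B C D + block_mat E F G K = block_mat (A + E) (B + F) (C + G) (D + K)"
  by (simp add: matrix_sum_eq_iff)

lemma block_mat_diff:
  "block_mat A B C D - block_mat E F G K = block_mat (A - E) (B - F) (C - G) (D - K)"
  by (simp add: matrix_sum_eq_iff)

lemma block_mat_uminus: "- block_mat A B C D = block_mat (- A) (- B) (- C) (- D)"
  by (simp add: matrix_sum_eq_iff)

lemma unitary_mult: "unitary A \<Longrightarrow> unitary B \<Longrightarrow> unitary (A ** B)"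
  unfolding unitary_def adj_mult by (metis matrix_mul_assoc matrix_mul_rid)

lemma unitary_nonzero:
  assumes "unitary (U :: complex ^ 'n ^ 'n)"
  shows "U \<noteq> 0"
proof
  assume "U = 0"
  then have "mat 1 = (0 :: complex ^ 'n ^ 'n)" using assms by (simp add: unitary_def)
  then have "mat 1 $ i $ i = (0 :: complex ^ 'n ^ 'n) $ i $ i" for i by simp
  then show False by (simp add: mat_def)
qed

text \<open>The common shape of \<open>phase_monomial\<close> and \<open>paley_Pi\<close>: the basis
  vector \<open>j\<close> goes to \<open>c j\<close> times the basis vector
  \<open>\<sigma> j\<close>.\<close>

definition monomial_mat :: "('n \<Rightarrow> 'm) \<Rightarrow> ('n \<Rightarrow> complex) \<Rightarrow> complex ^ 'n ^ 'm" where
  "monomial_mat \<sigma> c = (\<chi> i j. if i = \<sigma> j then c j else 0)"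

lemma monomial_mat_nth: "monomial_mat \<sigma> c $ i $ j = (if i = \<sigma> j then c j else 0)"
  by (simp add: monomial_mat_def)

lemma mult_monomial_mat_nth: "(A ** monomial_mat \<sigma> c) $ i $ j = A $ i $ \<sigma> j * c j"
  by (simp add: matrix_matrix_mult_def monomial_mat_nth if_distrib cong: if_cong)

lemma monomial_mat_mult_nth:
  assumes "inj \<sigma>"
  shows "(monomial_mat \<sigma> c ** A) $ \<sigma> i $ j = c i * A $ i $ j"
proof -
  have "(if \<sigma> i = \<sigma> k then c k else 0) * A $ k $ j = (if i = k then c k * A $ k $ j else 0)" for k
    using assms by (auto dest: injD)
  then show ?thesis by (simp add: matrix_matrix_mult_def monomial_mat_nth)
qed

lemma monomial_mat_mult:
  "monomial_mat \<sigma> c ** monomial_mat \<tau> d = monomial_mat (\<sigma> \<circ> \<tau>) (\<lambda>j. c (\<tau> j) * d j)"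
  by (simp add: matrix_eq_iff mult_monomial_mat_nth monomial_mat_nth)

lemma unitary_monomial_mat:
  fixes \<sigma> :: "'n::finite \<Rightarrow> 'n"
  assumes "bij \<sigma>" and "\<And>j. cmod (c j) = 1"
  shows "unitary (monomial_mat \<sigma> c)"
proof -
  have c: "cnj (c j) * c j = 1" "c j * cnj (c j) = 1" for j
    using assms(2)[of j] by (metis complex_norm_square mult.commute of_real_1 one_power2)+
  have "adj (monomial_mat \<sigma> c) ** monomial_mat \<sigma> c = mat 1"
    using assms(1)
    by (auto simp: matrix_eq_iff mult_monomial_mat_nth monomial_mat_nth mat_def c dest: bij_is_inj injD)
  then show ?thesis unfolding unitary_def using matrix_left_right_inverse by blast
qed

section \<open>Dihedral groups\<close>

context group
begin

text \<open>\<open>m'\<close> is a separate variable because the rule is applied once from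
  \<open>m\<close> to its inverse and once in the opposite direction.\<close>

lemma commute_nat_pow:
  assumes "m \<in> carrier G" "m' \<in> carrier G" "t \<in> carrier G" "t \<otimes> m = m' \<otimes> t"
  shows "t \<otimes> m [^] (k::nat) = m' [^] k \<otimes> t"
proof (induction k)
  case (Suc k)
  have "t \<otimes> m [^] Suc k = (t \<otimes> m [^] k) \<otimes> m" using assms by (simp add: m_assoc)
  also have "\<dots> = m' [^] k \<otimes> (t \<otimes> m)" using assms by (simp add: Suc m_assoc)
  also have "\<dots> = m' [^] Suc k \<otimes> t" using assms by (simp add: m_assoc)
  finally show ?case .
qed (use assms in simp)

lemma commute_int_pow:
  assumes "m \<in> carrier G" "t \<in> carrier G" "t \<otimes> m = inv m \<otimes> t"
  shows "t \<otimes> m [^] (k::int) = m [^] (- k) \<otimes> t"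
proof -
  have "t \<otimes> inv m = m \<otimes> t"
  proof -
    have "m \<otimes> t \<otimes> m = t"
      using assms by (metis inv_solve_left' m_assoc m_closed inv_closed r_inv l_one)
    then show ?thesis using assms by (metis inv_solve_right m_closed)
  qed
  then have *: "t \<otimes> inv m [^] k = m [^] k \<otimes> t" for k :: nat
    using assms by (intro commute_nat_pow) auto
  have **: "t \<otimes> m [^] k = inv m [^] k \<otimes> t" for k :: nat
    using assms by (intro commute_nat_pow) auto
  show ?thesis
    by (cases k rule: int_cases2)
      (use * ** assms in \<open>auto simp: int_pow_int int_pow_neg nat_pow_inv\<close>)
qed

text \<open>The map sending \<open>(i, s)\<close> to the power \<open>i\<close> of \<open>m\<close>,
  followed by \<open>t\<close> if \<open>s\<close> holds, is multiplicative because \<open>t\<close>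
  inverts \<open>m\<close>. It is injective because \<open>ord m = n\<close> and \<open>t\<close> is
  no power of \<open>m\<close>.\<close>

lemma dihedral_generate:
  assumes m: "m \<in> carrier G" and t: "t \<in> carrier G" and n: "ord m = n" "n > 0"
    and tt: "t \<otimes> t = \<one>" and tm: "t \<otimes> m = inv m \<otimes> t"
    and t_notin: "t \<notin> generate G {m}"
  shows "generate G {m, t} = generate G {m} \<union> (\<lambda>g. g \<otimes> t) ` generate G {m}" (is ?gen)
    and "G\<lparr>carrier := generate G {m, t}\<rparr> \<cong> dihedral_group n" (is ?iso)
proof -
  define \<phi> where "\<phi> = (\<lambda>(i::int, s). m [^] i \<otimes> (if s then t else \<one>))"
  have pow_mod: "m [^] (k mod int n) = m [^] k" for k :: int
  proof -
    have "m [^] (k - k mod int n) = \<one>"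
      using m n by (simp add: int_pow_eq_id)
    then have "m [^] k \<otimes> inv (m [^] (k mod int n)) = \<one>"
      using m by (simp add: int_pow_diff)
    then show ?thesis using m by (metis int_pow_closed inv_equality inv_inv inv_closed)
  qed
  have tpow: "t \<otimes> m [^] k = m [^] (- k) \<otimes> t" for k :: int
    using commute_int_pow[OF m t tm] .
  have tmt: "t \<otimes> (m [^] k \<otimes> t) = m [^] (- k)" for k :: int
    using m t tt by (simp add: m_assoc[symmetric] tpow) (simp add: m_assoc)
  have hom: "\<phi> (x \<otimes>\<^bsub>dihedral_group n\<^esub> y) = \<phi> x \<otimes> \<phi> y" for x y
  proof -
    obtain i s j u where xy: "x = (i, s)" "y = (j, u)" by (cases x, cases y) auto
    have "\<phi> x \<otimes> \<phi> y = m [^] i \<otimes> ((if s then t else \<one>) \<otimes> m [^] j) \<otimes> (if u then t else \<one>)"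
      using m t by (simp add: xy \<phi>_def m_assoc)
    also have "\<dots> = m [^] (if s then i - j else i + j) \<otimes> (if s \<noteq> u then t else \<one>)"
      using m t tpow[of j] tmt[of j] by (auto simp: m_assoc int_pow_mult int_pow_diff int_pow_neg)
    finally show ?thesis
      using pow_mod by (simp add: xy \<phi>_def dihedral_group_def)
  qed
  have pow_gen: "m [^] k \<in> generate G {m}" for k :: int
    using generate_pow[OF m] by auto
  have inj: "inj_on \<phi> (carrier (dihedral_group n))"
  proof (rule inj_onI)
    fix x y
    assume xy: "x \<in> carrier (dihedral_group n)" "y \<in> carrier (dihedral_group n)" "\<phi> x = \<phi> y"
    obtain i s j u where eq: "x = (i, s)" "y = (j, u)" by (cases x, cases y) auto
    have *: "m [^] i \<otimes> (if s then t else \<one>) = m [^] j \<otimes> (if u then t else \<one>)"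
      using xy(3) by (simp add: eq \<phi>_def)
    have move: "t = m [^] (l - k)" if "m [^] k \<otimes> t = m [^] l" for k l :: int
    proof -
      have "t = inv (m [^] k) \<otimes> m [^] l" using that m t by (simp add: inv_solve_left)
      then show ?thesis using m by (simp add: int_pow_neg[symmetric] int_pow_mult[symmetric])
    qed
    have su: "s = u"
    proof (rule ccontr)
      assume "s \<noteq> u"
      then have "m [^] i \<otimes> t = m [^] j \<or> m [^] j \<otimes> t = m [^] i"
        using * m t by (auto split: if_splits)
      then show False using move pow_gen t_notin by metis
    qed
    then have "m [^] i = m [^] j" using * m t by (auto split: if_splits)
    then have "m [^] (i - j) = \<one>" using m by (simp add: int_pow_diff)
    then have "int n dvd i - j" using int_pow_eq_id[OF m] n by simp
    then have "i mod int n = j mod int n" by (simp add: mod_eq_dvd_iff)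
    then have "i = j" using xy(1,2) by (simp add: eq dihedral_group_def)
    then show "x = y" using su by (simp add: eq)
  qed
  let ?D = "generate G {m} \<union> (\<lambda>g. g \<otimes> t) ` generate G {m}"
  have im: "\<phi> ` carrier (dihedral_group n) = ?D"
  proof (intro subset_antisym subsetI)
    fix g assume "g \<in> \<phi> ` carrier (dihedral_group n)"
    then show "g \<in> ?D" using pow_gen m by (auto simp: \<phi>_def split: if_splits)
  next
    fix g assume "g \<in> ?D"
    then obtain k :: int where "g = m [^] k \<or> g = m [^] k \<otimes> t"
      using generate_pow[OF m] by auto
    then have "g = \<phi> (k mod int n, False) \<or> g = \<phi> (k mod int n, True)"
      using m by (auto simp: \<phi>_def pow_mod)
    moreover have "(k mod int n, b) \<in> carrier (dihedral_group n)" for b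
      using n by (simp add: dihedral_group_def)
    ultimately show "g \<in> \<phi> ` carrier (dihedral_group n)" by blast
  qed
  have sub: "?D \<subseteq> generate G {m, t}"
    using mono_generate[of "{m}" "{m, t}"] by (auto intro: generate.eng generate.incl)
  have dihedral_closed:
    "x \<in> carrier (dihedral_group n) \<Longrightarrow> y \<in> carrier (dihedral_group n)
      \<Longrightarrow> x \<otimes>\<^bsub>dihedral_group n\<^esub> y \<in> carrier (dihedral_group n)" for x y
    using n by (auto simp: dihedral_group_def)
  have "g \<in> ?D" if "g \<in> generate G {m, t}" for g
    using that
  proof (induction rule: generate.induct)
    case (incl h)
    moreover have "\<one> \<otimes> t \<in> ?D" using generate.one by blast
    ultimately show ?case using t by (auto intro: generate.incl)
  next
    case (inv h)
    moreover have "\<one> \<otimes> t \<in> ?D" using generate.one by blast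
    moreover have "inv t = t" using inv_equality[OF tt t t] .
    ultimately show ?case using t by (auto intro: generate.inv)
  next
    case (eng g h)
    \<comment> \<open>As \<open>?D\<close> is the image of a multiplicative map, closure under
      products is inherited from the dihedral group, with no case analysis on the two
      cosets.\<close>
    then show ?case unfolding im[symmetric] by (auto simp: hom[symmetric] intro: dihedral_closed)
  qed (simp add: generate.one)
  with sub show gen: ?gen by blast
  \<comment> \<open>\<open>\<phi>\<close> starts at the dihedral group, whereas the isomorphism
    required ends there.\<close>
  have "inv_into (carrier (dihedral_group n)) \<phi>
      \<in> iso (G\<lparr>carrier := generate G {m, t}\<rparr>) (dihedral_group n)"
  proof (rule isoI)
    let ?\<psi> = "inv_into (carrier (dihedral_group n)) \<phi>"
    have gen_im: "generate G {m, t} = \<phi> ` carrier (dihedral_group n)"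
      using gen im by simp
    show "bij_betw ?\<psi> (carrier (G\<lparr>carrier := generate G {m, t}\<rparr>)) (carrier (dihedral_group n))"
      using inj by (simp add: gen_im bij_betw_inv_into bij_betw_imageI)
    have "?\<psi> (\<phi> x \<otimes> \<phi> y) = ?\<psi> (\<phi> x) \<otimes>\<^bsub>dihedral_group n\<^esub> ?\<psi> (\<phi> y)"
      if "x \<in> carrier (dihedral_group n)" "y \<in> carrier (dihedral_group n)" for x y
      using that inj dihedral_closed by (simp add: hom[symmetric])
    moreover have "?\<psi> (\<phi> x) \<in> carrier (dihedral_group n)"
      if "x \<in> carrier (dihedral_group n)" for x
      using that by (intro inv_into_into) auto
    ultimately show "?\<psi> \<in> Group.hom (G\<lparr>carrier := generate G {m, t}\<rparr>) (dihedral_group n)"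
      by (auto simp: hom_def gen_im)
  qed
  then show ?iso by (intro is_isoI)
qed

end

lemma order_dihedral_group: "order (dihedral_group n) = 2 * n"
  by (simp add: order_def dihedral_group_def card_cartesian_product)

section \<open>The projective linear group\<close>

lemma mat_mult_nth [simp]: "(mat c ** A) $ i $ j = (c :: 'a::field) * A $ i $ j"
  by (simp add: matrix_matrix_mult_def mat_def if_distrib if_distribR cong: if_cong)

lemma mat_vmult [simp]: "mat c *v x = (c :: 'a::field) *s x"
  by (simp add: vec_eq_iff matrix_vector_mult_def mat_def if_distrib if_distribR cong: if_cong)

lemma mat22_nth [simp]:
  "mat22 a b c d $ 1 $ 1 = a" "mat22 a b c d $ 1 $ 2 = b"
  "mat22 a b c d $ 2 $ 1 = c" "mat22 a b c d $ 2 $ 2 = d"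
  by (simp_all add: mat22_def)

lemma mat_nth_2 [simp]:
  "mat c $ 1 $ 1 = c" "mat c $ 1 $ (2::2) = 0" "mat c $ (2::2) $ 1 = 0" "mat c $ 2 $ (2::2) = c"
  by (simp_all add: mat_def)

lemma matrix_mult_nth_2: "(A ** (B :: 'a::semiring_1 ^ 'n ^ 2)) $ i $ j = A $ i $ 1 * B $ 1 $ j + A $ i $ 2 * B $ 2 $ j"
  by (simp add: matrix_matrix_mult_def sum_2)

lemma matrix_vmult_nth_2: "(A *v (x :: 'a::semiring_1 ^ 2)) $ i = A $ i $ 1 * x $ 1 + A $ i $ 2 * x $ 2"
  by (simp add: matrix_vector_mult_def sum_2)

lemma matrix_eq_2: "(A :: 'a ^ 2 ^ 2) = B \<longleftrightarrow>
    A $ 1 $ 1 = B $ 1 $ 1 \<and> A $ 1 $ 2 = B $ 1 $ 2 \<and> A $ 2 $ 1 = B $ 2 $ 1 \<and> A $ 2 $ 2 = B $ 2 $ 2"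
  by (auto simp: vec_eq_iff forall_2)

lemma det_mat_mult_2: "det (mat c ** (A :: 'a::field ^ 2 ^ 2)) = c\<^sup>2 * det A"
  by (simp add: det_2 power2_eq_square algebra_simps)

lemma GL2_simps [simp]:
  "A \<in> carrier GL2 \<longleftrightarrow> invertible A" "A \<otimes>\<^bsub>GL2\<^esub> B = A ** B" "\<one>\<^bsub>GL2\<^esub> = mat 1"
  by (simp_all add: GL2_def)

lemma group_GL2: "group (GL2 :: ('a::field ^ 2 ^ 2) monoid)"
proof (rule groupI)
  fix A :: "'a ^ 2 ^ 2" assume "A \<in> carrier GL2"
  then show "\<exists>B\<in>carrier GL2. B \<otimes>\<^bsub>GL2\<^esub> A = \<one>\<^bsub>GL2\<^esub>"
    unfolding GL2_def by simp (metis invertible_def)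
qed (auto simp: matrix_mul_assoc invertible_mult, simp add: invertible_def exI[of _ "mat 1"])

lemma scalars2_iff: "A \<in> scalars2 \<longleftrightarrow> (\<exists>c. c \<noteq> 0 \<and> A = mat c)"
  by (auto simp: scalars2_def)

lemma normal_scalars2: "scalars2 \<lhd> (GL2 :: ('a::field ^ 2 ^ 2) monoid)"
proof -
  interpret group "GL2 :: ('a ^ 2 ^ 2) monoid" by (rule group_GL2)
  have mm: "mat c ** mat d = (mat (c * d) :: 'a ^ 2 ^ 2)" for c d
    by (simp add: matrix_eq_2)
  have inv_mat: "mat c ** mat (1 / c) = (mat 1 :: 'a ^ 2 ^ 2)" "mat (1 / c) ** mat c = (mat 1 :: 'a ^ 2 ^ 2)"
    if "c \<noteq> 0" for c
    using that by (simp_all add: mm)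
  have inv_eq: "inv\<^bsub>GL2\<^esub> (mat c) = (mat (1 / c) :: 'a ^ 2 ^ 2)" if "c \<noteq> 0" for c
    using that inv_mat[OF that] by (intro inv_equality) (auto simp: invertible_def)
  have sub: "subgroup scalars2 (GL2 :: ('a ^ 2 ^ 2) monoid)"
  proof (rule subgroupI)
    show "scalars2 \<subseteq> carrier (GL2 :: ('a ^ 2 ^ 2) monoid)"
      using inv_mat by (force simp: scalars2_iff invertible_def)
    show "scalars2 \<noteq> ({} :: ('a ^ 2 ^ 2) set)"
      by (auto simp: scalars2_def intro: exI[of _ 1])
  next
    fix A :: "'a ^ 2 ^ 2" assume "A \<in> scalars2"
    then obtain c where "c \<noteq> 0" "A = mat c" by (auto simp: scalars2_iff)
    then show "inv\<^bsub>GL2\<^esub> A \<in> scalars2" by (auto simp: scalars2_iff inv_eq intro!: exI[of _ "1 / c"])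
  next
    fix A B :: "'a ^ 2 ^ 2" assume "A \<in> scalars2" "B \<in> scalars2"
    then show "A \<otimes>\<^bsub>GL2\<^esub> B \<in> scalars2" unfolding scalars2_iff by (metis GL2_simps(2) mm mult_eq_0_iff)
  qed
  have comm: "A ** mat c = mat c ** A" for A :: "'a ^ 2 ^ 2" and c
    by (simp add: matrix_eq_2 matrix_mult_nth_2 mult.commute)
  show ?thesis
    by (rule normalI[OF sub]) (auto simp: r_coset_def l_coset_def scalars2_def comm)
qed

lemma group_PGL2: "group (PGL2 :: ('a::field ^ 2 ^ 2) set monoid)"
  unfolding PGL2_def by (rule normal.factorgroup_is_group[OF normal_scalars2])

lemma pclass_iff: "B \<in> pclass A \<longleftrightarrow> (\<exists>c. c \<noteq> 0 \<and> B = mat c ** A)"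
  by (auto simp: pclass_def r_coset_def scalars2_def)

lemma pclass_self: "A \<in> pclass A"
  by (auto simp: pclass_iff intro!: exI[of _ 1])

lemma pclass_eq_iff: "pclass A = pclass B \<longleftrightarrow> (\<exists>c. c \<noteq> 0 \<and> A = mat c ** B)"
proof
  assume "pclass A = pclass B"
  then show "\<exists>c. c \<noteq> 0 \<and> A = mat c ** B" using pclass_self[of A] by (simp add: pclass_iff)
next
  assume "\<exists>c. c \<noteq> 0 \<and> A = mat c ** B"
  then obtain c where c: "c \<noteq> 0" "A = mat c ** B" by blast
  have "(\<exists>d. d \<noteq> 0 \<and> C = mat d ** A) \<longleftrightarrow> (\<exists>d. d \<noteq> 0 \<and> C = mat d ** B)" for C
  proof
    assume "\<exists>d. d \<noteq> 0 \<and> C = mat d ** A"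
    then obtain d where "d \<noteq> 0" "C = mat d ** A" by blast
    then have "d * c \<noteq> 0" "C = mat (d * c) ** B"
      using c by (auto simp: matrix_eq_2 mult.assoc)
    then show "\<exists>d. d \<noteq> 0 \<and> C = mat d ** B" by blast
  next
    assume "\<exists>d. d \<noteq> 0 \<and> C = mat d ** B"
    then obtain d where "d \<noteq> 0" "C = mat d ** B" by blast
    then have "d / c \<noteq> 0" "C = mat (d / c) ** A"
      using c by (auto simp: matrix_eq_2)
    then show "\<exists>d. d \<noteq> 0 \<and> C = mat d ** A" by blast
  qed
  then show "pclass A = pclass B" by (auto simp: pclass_iff set_eq_iff)
qed

lemma carrier_PGL2: "carrier PGL2 = pclass ` {A :: 'a::field ^ 2 ^ 2. det A \<noteq> 0}"
  by (auto simp: PGL2_def carrier_FactGroup pclass_def invertible_det_nz)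

lemma pclass_carrier: "det A \<noteq> 0 \<Longrightarrow> pclass A \<in> carrier PGL2"
  by (auto simp: carrier_PGL2)

lemma pclass_mult:
  "det A \<noteq> 0 \<Longrightarrow> det B \<noteq> 0 \<Longrightarrow> pclass A \<otimes>\<^bsub>PGL2\<^esub> pclass B = pclass (A ** B)"
  using normal.rcos_sum[OF normal_scalars2, of A B] by (simp add: PGL2_def pclass_def invertible_det_nz)

lemma one_PGL2: "\<one>\<^bsub>PGL2\<^esub> = pclass (mat 1)"
  by (auto simp: PGL2_def pclass_iff scalars2_iff set_eq_iff)

lemma pclass_eq_self:
  assumes "g \<in> carrier PGL2" "A \<in> g"
  shows "g = pclass A \<and> det A \<noteq> 0"
proof -
  obtain B where B: "det B \<noteq> 0" "g = pclass B" using assms(1) by (auto simp: carrier_PGL2)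
  then obtain c where c: "c \<noteq> 0" "A = mat c ** B" using assms(2) by (auto simp: pclass_iff)
  then have "pclass A = pclass B" by (auto simp: pclass_eq_iff)
  then show ?thesis using B c by (simp add: det_mat_mult_2)
qed

text \<open>Rescaling a representative multiplies its determinant by a square, so a class fixes the
  determinant modulo squares; determinant \<open>b\<^sup>2\<close> is normalised to 1 by the scalar
  \<open>1 / b\<close>.\<close>

lemma pclass_in_PSL2:
  fixes A :: "'a::{field,finite} ^ 2 ^ 2"
  assumes "det A \<noteq> 0"
  shows "pclass A \<in> PSL2 \<longleftrightarrow> quad_char (det A) = 1"
proof -
  have "pclass A \<in> PSL2 \<longleftrightarrow> (\<exists>B. det B = 1 \<and> pclass A = pclass B)"
    by (auto simp: PSL2_def)
  also have "\<dots> \<longleftrightarrow> (\<exists>b. det A = b\<^sup>2)"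
  proof
    assume "\<exists>B. det B = 1 \<and> pclass A = pclass B"
    then show "\<exists>b. det A = b\<^sup>2" by (auto simp: pclass_eq_iff det_mat_mult_2)
  next
    assume "\<exists>b. det A = b\<^sup>2"
    then obtain b where b: "det A = b\<^sup>2" by blast
    then have "b \<noteq> 0" using assms by auto
    then have "det (mat (1 / b) ** A) = 1" "pclass A = pclass (mat (1 / b) ** A)"
      by (auto simp: det_mat_mult_2 b power_divide pclass_eq_iff matrix_eq_2 intro!: exI[of _ b])
    then show "\<exists>B. det B = 1 \<and> pclass A = pclass B" by blast
  qed
  finally show ?thesis by (simp add: quad_char_def)
qed

section \<open>The projective line\<close>

text \<open>Meaningful only for nonzero \<open>x\<close>: the zero vector spans no line, and
  \<open>Proj\<close> is then applied outside its domain.\<close>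

definition pt :: "'a::field ^ 2 \<Rightarrow> 'a proj_line" where
  "pt x = Proj (vec.span {x})"

text \<open>The determinant with columns \<open>x\<close> and \<open>y\<close>, whose character is
  the entry of the Paley matrix. As an alternating form it also detects equality of projective
  points.\<close>

definition cross2 :: "'a::field ^ 2 \<Rightarrow> 'a ^ 2 \<Rightarrow> 'a" where
  "cross2 x y = x $ 1 * y $ 2 - x $ 2 * y $ 1"

lemma vec2_eq_iff: "(x :: 'a ^ 2) = y \<longleftrightarrow> x $ 1 = y $ 1 \<and> x $ 2 = y $ 2"
  by (simp add: vec_eq_iff forall_2)

lemma cross2_self [simp]: "cross2 x x = 0"
  by (simp add: cross2_def)

lemma cross2_swap: "cross2 y x = - cross2 x y"
  by (simp add: cross2_def)

lemma cross2_scale [simp]: "cross2 (c *s x) y = c * cross2 x y" "cross2 x (c *s y) = c * cross2 x y"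
  by (simp_all add: cross2_def algebra_simps)

lemma cross2_vmult: "cross2 (A *v x) (A *v y) = det A * cross2 x y"
  by (simp add: cross2_def matrix_vmult_nth_2 det_2 algebra_simps)

lemma cross2_eq_0_iff:
  assumes "x \<noteq> 0" "y \<noteq> 0"
  shows "cross2 x y = 0 \<longleftrightarrow> (\<exists>c. c \<noteq> 0 \<and> x = c *s y)"
proof
  assume *: "cross2 x y = 0"
  consider "y $ 1 \<noteq> 0" | "y $ 2 \<noteq> 0" using assms by (auto simp: vec2_eq_iff)
  then obtain c where "x = c *s y"
  proof cases
    case 1
    then have "x = (x $ 1 / y $ 1) *s y"
      using * by (simp add: vec2_eq_iff cross2_def field_simps)
    then show ?thesis using that by blast
  next
    case 2
    then have "x = (x $ 2 / y $ 2) *s y"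
      using * by (simp add: vec2_eq_iff cross2_def field_simps)
    then show ?thesis using that by blast
  qed
  then show "\<exists>c. c \<noteq> 0 \<and> x = c *s y" using assms by auto
qed auto

lemma span_eq: "vec.span {x :: 'a::field ^ 2} = range (\<lambda>k. k *s x)"
  by (rule vec.span_singleton)

lemma line_of_pt: "x \<noteq> 0 \<Longrightarrow> line_of (pt x) = range (\<lambda>k. k *s x)"
  unfolding pt_def span_eq[symmetric] by (rule Proj_inverse) auto

lemma pt_eq_iff_scale:
  assumes "x \<noteq> 0" "y \<noteq> 0"
  shows "pt x = pt y \<longleftrightarrow> (\<exists>c. c \<noteq> 0 \<and> x = c *s y)"
proof
  assume "pt x = pt y"
  then have "range (\<lambda>k. k *s x) = range (\<lambda>k. k *s y)" using assms line_of_pt by metis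
  moreover have "1 *s x \<in> range (\<lambda>k. k *s x)" by blast
  ultimately obtain c where "x = c *s y" by auto
  then show "\<exists>c. c \<noteq> 0 \<and> x = c *s y" using assms by auto
next
  assume "\<exists>c. c \<noteq> 0 \<and> x = c *s y"
  then obtain c where c: "c \<noteq> 0" "x = c *s y" by blast
  have "k *s y \<in> range (\<lambda>k. k *s x)" for k
    using c by (auto intro!: rev_image_eqI[of "k / c"])
  then have "range (\<lambda>k. k *s x) = range (\<lambda>k. k *s y)" using c by auto
  then show "pt x = pt y" by (simp add: pt_def span_eq)
qed

lemma pt_eq_iff: "x \<noteq> 0 \<Longrightarrow> y \<noteq> 0 \<Longrightarrow> pt x = pt y \<longleftrightarrow> cross2 x y = 0"
  by (simp add: pt_eq_iff_scale cross2_eq_0_iff)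

lemma pt_cases:
  obtains x where "x \<noteq> 0" "P = pt x"
proof -
  obtain x where "x \<noteq> 0" "line_of P = vec.span {x}" using line_of[of P] by auto
  then have "P = pt x" unfolding pt_def by (metis line_of_inverse)
  with \<open>x \<noteq> 0\<close> show ?thesis by (rule that)
qed

lemma vmult_eq_0_iff:
  assumes "det (A :: 'a::field ^ 2 ^ 2) \<noteq> 0"
  shows "A *v x = 0 \<longleftrightarrow> x = 0"
proof
  assume *: "A *v x = 0"
  obtain B where "B ** A = mat 1" using assms invertible_det_nz invertible_left_inverse by blast
  then have "x = B *v (A *v x)" by (simp add: matrix_vector_mul_assoc)
  with * show "x = 0" by simp
qed simp

text \<open>Scalars from the class and from the line together sweep out exactly one line, so
  \<open>Proj\<close> receives a genuine line and one representative of each suffices.\<close>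

lemma pgl_act_pclass:
  assumes "det A \<noteq> 0" "x \<noteq> 0"
  shows "pgl_act (pclass A) (pt x) = pt (A *v x)"
proof -
  have "{B *v y | B y. B \<in> pclass A \<and> y \<in> line_of (pt x)} = range (\<lambda>k. k *s (A *v x))" (is "?L = ?R")
  proof (intro subset_antisym subsetI)
    fix v assume "v \<in> ?L"
    then obtain c k where "v = (mat c ** A) *v (k *s x)"
      using assms(2) by (auto simp: pclass_iff line_of_pt)
    then have "v = (c * k) *s (A *v x)"
      by (simp add: vec2_eq_iff matrix_vmult_nth_2 algebra_simps)
    then show "v \<in> ?R" by blast
  next
    fix v assume "v \<in> ?R"
    then obtain k where "v = k *s (A *v x)" by blast
    then have "v = A *v (k *s x)" by (simp add: vec2_eq_iff matrix_vmult_nth_2 algebra_simps)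
    then show "v \<in> ?L" using pclass_self[of A] assms(2) line_of_pt by blast
  qed
  then show ?thesis by (simp add: pgl_act_def pt_def span_eq)
qed

text \<open>The option type is the standard chart: affine points \<open>[x : 1]\<close> and the
  point \<open>[1 : 0]\<close> at infinity.\<close>

lemma card_proj_line: "CARD('a::{field,finite} proj_line) = CARD('a) + 1"
proof -
  define f :: "'a option \<Rightarrow> 'a proj_line" where
    "f z = pt (case z of None \<Rightarrow> vector [1, 0] | Some x \<Rightarrow> vector [x, 1])" for z
  have nz: "(vector [1, 0] :: 'a ^ 2) \<noteq> 0" "(vector [x, 1] :: 'a ^ 2) \<noteq> 0" for x
    by (simp_all add: vec2_eq_iff)
  have "inj f"
    by (rule injI) (auto simp: f_def pt_eq_iff nz cross2_def split: option.splits)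
  moreover have "\<exists>z. P = f z" for P
  proof -
    obtain x where x: "x \<noteq> 0" "P = pt x" by (rule pt_cases)
    show ?thesis
    proof (cases "x $ 2 = 0")
      case True
      then have "P = f None" using x by (simp add: f_def pt_eq_iff nz cross2_def)
      then show ?thesis ..
    next
      case False
      then have "P = f (Some (x $ 1 / x $ 2))" using x by (simp add: f_def pt_eq_iff nz cross2_def)
      then show ?thesis ..
    qed
  qed
  ultimately have "bij f" by (auto simp: bij_def surj_def)
  then show ?thesis using bij_betw_same_card[of f UNIV UNIV] by (simp add: card_UNIV_option)
qed

section \<open>Automorphisms of the Paley matrices\<close>

text \<open>A strict representation sends commuting elements to commuting unitaries, and this survives equivalence.\<close>

lemma genuine_rep_if_anticommute:
  assumes proj: "projective_unitary_rep G \<pi>"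
    and z: "z \<in> carrier G" and t: "t \<in> carrier G"
    and comm: "z \<otimes>\<^bsub>G\<^esub> t = t \<otimes>\<^bsub>G\<^esub> z"
    and anti: "\<pi> z ** \<pi> t = - (\<pi> t ** \<pi> z)"
  shows "genuine_rep G \<pi>"
  unfolding genuine_rep_def
proof (intro conjI notI)
  assume "\<exists>\<rho>. strict_unitary_rep G \<rho> \<and> rep_equivalent G \<pi> \<rho>"
  then obtain \<rho> U where \<rho>: "strict_unitary_rep G \<rho>" and U: "unitary U"
    and eq: "\<And>g. g \<in> carrier G \<Longrightarrow> \<exists>c. cmod c = 1 \<and> \<pi> g = cscale c (U ** \<rho> g ** adj U)"
    unfolding rep_equivalent_def by blast
  obtain c d where cd: "\<pi> z = cscale c (U ** \<rho> z ** adj U)" "\<pi> t = cscale d (U ** \<rho> t ** adj U)"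
    using eq z t by metis
  have "\<rho> z ** \<rho> t = \<rho> t ** \<rho> z"
    using \<rho> z t comm unfolding strict_unitary_rep_def by metis
  moreover have "(U ** A ** adj U) ** (U ** B ** adj U) = U ** (A ** B) ** adj U" for A B
    using U unfolding unitary_def by (metis matrix_mul_assoc matrix_mul_rid)
  ultimately have "\<pi> z ** \<pi> t = \<pi> t ** \<pi> z"
    by (simp add: cd cscale_mult_left cscale_mult_right mult.commute)
  with anti have "\<pi> z ** \<pi> t = 0" by (simp add: matrix_eq_iff)
  moreover have "unitary (\<pi> z ** \<pi> t)"
    using proj z t unfolding projective_unitary_rep_def by (auto intro: unitary_mult)
  ultimately show False using unitary_nonzero by blast
qed (rule proj)

lemma transpose_nth [simp]: "transpose A $ i $ j = A $ j $ i"
  by (simp add: transpose_def)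

lemmas PGL2_mult_closed = monoid.m_closed[OF group.is_monoid[OF group_PGL2]]

lemma pgl_act_mult:
  assumes "g \<in> carrier PGL2" "h \<in> carrier PGL2"
  shows "pgl_act (g \<otimes>\<^bsub>PGL2\<^esub> h) P = pgl_act g (pgl_act h P)"
proof -
  obtain A B where A: "g = pclass A" "det A \<noteq> 0" and B: "h = pclass B" "det B \<noteq> 0"
    using assms by (auto simp: carrier_PGL2)
  obtain x where x: "x \<noteq> 0" "P = pt x" by (rule pt_cases)
  then have "B *v x \<noteq> 0" using B by (simp add: vmult_eq_0_iff)
  then show ?thesis
    using A B x by (simp add: pclass_mult pgl_act_pclass det_mul matrix_vector_mul_assoc)
qed

lemma bij_pgl_act:
  assumes "g \<in> carrier (PGL2 :: ('a::{field,finite} ^ 2 ^ 2) set monoid)"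
  shows "bij (pgl_act g)"
proof -
  obtain A where A: "g = pclass A" "det A \<noteq> 0"
    using assms by (auto simp: carrier_PGL2)
  have "inj (pgl_act g)"
  proof (rule injI)
    fix P Q assume eq: "pgl_act g P = pgl_act g Q"
    obtain x where x: "x \<noteq> 0" "P = pt x" by (rule pt_cases)
    obtain y where y: "y \<noteq> 0" "Q = pt y" by (rule pt_cases)
    show "P = Q" using eq A x y
      by (simp add: pgl_act_pclass pt_eq_iff vmult_eq_0_iff cross2_vmult)
  qed
  then show ?thesis by (simp add: finite_UNIV_inj_surj bij_def)
qed

locale paley =
  fixes rep :: "'a::{field,finite} proj_line \<Rightarrow> 'a ^ 2"
    and lift :: "('a ^ 2 ^ 2) set \<Rightarrow> 'a ^ 2 ^ 2"
  assumes card_mod_4: "CARD('a) mod 4 = 3"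
    and valid_reps: "valid_reps rep" and valid_lifts: "valid_lifts lift"
begin

abbreviation "H \<equiv> paley_H rep"
abbreviation "PM \<equiv> paley_Pi rep lift"
abbreviation "DPM \<equiv> paley_DPi rep lift"
abbreviation "scl \<equiv> scaling_factor rep lift"

lemmas chi_mult = quad_char_mult[OF card_mod_4]
lemmas chi_minus = quad_char_minus[OF card_mod_4]

lemma rep_nonzero [simp]: "rep P \<noteq> 0"
  using valid_reps by (simp add: valid_reps_def)

lemma pt_rep [simp]: "pt (rep P) = P"
proof -
  obtain x where x: "x \<noteq> 0" "P = pt x" by (rule pt_cases)
  have "rep P \<in> line_of P" using valid_reps by (simp add: valid_reps_def)
  then obtain k where k: "rep P = k *s x" using x line_of_pt by auto
  then have "k \<noteq> 0" using rep_nonzero[of P] by auto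
  then show ?thesis using x k pt_eq_iff_scale[of "rep P" x] by auto
qed

lemma cross2_rep_eq_0_iff: "cross2 (rep P) (rep Q) = 0 \<longleftrightarrow> P = Q"
  using pt_eq_iff[of "rep P" "rep Q"] by simp

lemma
  assumes "g \<in> carrier PGL2"
  shows pclass_lift: "pclass (lift g) = g" and det_lift: "det (lift g) \<noteq> 0"
  using valid_lifts assms pclass_eq_self unfolding valid_lifts_def by blast+

lemma PSL2_iff_lift: "g \<in> carrier PGL2 \<Longrightarrow> g \<in> PSL2 \<longleftrightarrow> quad_char (det (lift g)) = 1"
  using pclass_in_PSL2 pclass_lift det_lift by metis

lemma lift_vmult_nonzero: "g \<in> carrier PGL2 \<Longrightarrow> lift g *v rep P \<noteq> 0"
  by (simp add: vmult_eq_0_iff det_lift)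

lemma pgl_act_lift:
  assumes "g \<in> carrier PGL2"
  shows "pgl_act g P = pt (lift g *v rep P)"
  using pgl_act_pclass[OF det_lift[OF assms], of "rep P"] by (simp add: pclass_lift assms)

lemma
  assumes "g \<in> carrier PGL2"
  shows scl_nonzero: "scl g P \<noteq> 0"
    and scl: "scl g P *s (lift g *v rep P) = rep (pgl_act g P)"
proof -
  have "pt (rep (pgl_act g P)) = pt (lift g *v rep P)"
    by (simp add: pgl_act_lift assms)
  then obtain c where c: "c \<noteq> 0" "rep (pgl_act g P) = c *s (lift g *v rep P)"
    using pt_eq_iff_scale lift_vmult_nonzero[OF assms] rep_nonzero by metis
  have "scl g P \<noteq> 0 \<and> scl g P *s (lift g *v rep P) = rep (pgl_act g P)"
    unfolding scaling_factor_def
    by (rule theI[where a = c])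
      (use c lift_vmult_nonzero[OF assms, of P] in \<open>auto simp: vec.scale_cancel_right\<close>)
  then show "scl g P \<noteq> 0" "scl g P *s (lift g *v rep P) = rep (pgl_act g P)" by auto
qed

lemma paley_H_nth: "H $ P $ Q = quad_char (cross2 (rep P) (rep Q))"
  by (simp add: paley_H_def cross2_def det_2 mult.commute)

text \<open>The determinant is alternating and nonzero at distinct points, and the character changes
  sign with a nonzero argument.\<close>

lemma paley_H_swap: "P \<noteq> Q \<Longrightarrow> H $ Q $ P = - H $ P $ Q"
  by (subst (1) paley_H_nth, subst cross2_swap)
    (simp add: paley_H_nth chi_minus cross2_rep_eq_0_iff)

lemma paley_H_diag [simp]: "H $ P $ P = 1"
  by (simp add: paley_H_nth)

text \<open>This is the skew condition, in a form that carries facts about \<open>H\<close> to its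
  transpose by linearity.\<close>

lemma transpose_paley_H: "transpose H = cscale 2 (mat 1) - H"
proof -
  have "transpose H $ P $ Q = (cscale 2 (mat 1) - H) $ P $ Q" for P Q
    using paley_H_swap[of P Q] by (cases "P = Q") (auto simp: mat_def)
  then show ?thesis unfolding matrix_eq_iff by blast
qed

lemma adj_paley_H: "adj H = transpose H"
  by (simp add: matrix_eq_iff paley_H_nth)

lemma paley_Pi_monomial: "PM g = monomial_mat (pgl_act g) (\<lambda>P. quad_char (scl g P))"
  by (simp add: paley_Pi_def monomial_mat_def)

lemma unitary_paley_Pi: "g \<in> carrier PGL2 \<Longrightarrow> unitary (PM g)"
  unfolding paley_Pi_monomial by (intro unitary_monomial_mat bij_pgl_act) auto

text \<open>Scaling factors and the determinant of the lift pull out of the alternating form. The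
  diagonal is excluded because the character is not multiplicative at 0.\<close>

lemma paley_H_act:
  assumes "g \<in> carrier PGL2" "P \<noteq> Q"
  shows "H $ pgl_act g P $ pgl_act g Q
    = quad_char (scl g P) * quad_char (scl g Q) * quad_char (det (lift g)) * H $ P $ Q"
proof -
  have "cross2 (rep (pgl_act g P)) (rep (pgl_act g Q))
    = scl g P * scl g Q * det (lift g) * cross2 (rep P) (rep Q)"
    by (simp add: scl[OF assms(1), symmetric] cross2_vmult)
  then show ?thesis
    using assms by (simp add: paley_H_nth chi_mult scl_nonzero det_lift cross2_rep_eq_0_iff)
qed

lemma paley_Pi_H:
  assumes g: "g \<in> carrier PGL2"
  shows "PM g ** H = (if g \<in> PSL2 then H else transpose H) ** PM g" (is "_ = ?H' ** _")
proof -
  have "(PM g ** H) $ R $ Q = (?H' ** PM g) $ R $ Q" for R Q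
  proof -
    obtain P where P: "R = pgl_act g P" using bij_pgl_act[OF g] by (metis bij_pointE)
    have "(PM g ** H) $ R $ Q = quad_char (scl g P) * H $ P $ Q"
      unfolding P paley_Pi_monomial
      by (rule monomial_mat_mult_nth[OF bij_is_inj[OF bij_pgl_act[OF g]]])
    \<comment> \<open>On the diagonal both matrices have entry 1. Off it, \<open>g\<close>
      contributes \<open>quad_char (det (lift g))\<close>; when this is -1, skewness turns the sign
      change into a transposition.\<close>
    also have "\<dots> = ?H' $ pgl_act g P $ pgl_act g Q * quad_char (scl g Q)"
    proof (cases "P = Q")
      case False
      then show ?thesis
        using paley_H_act[OF g False] paley_H_act[OF g False[symmetric]] paley_H_swap[OF False]
          PSL2_iff_lift[OF g] quad_char_cases[of "det (lift g)"] quad_char_cases[of "scl g Q"]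
        by auto
    qed auto
    finally show ?thesis by (simp add: P paley_Pi_monomial mult_monomial_mat_nth)
  qed
  then show ?thesis by (simp add: matrix_eq_iff)
qed

lemma paley_Pi_transpose_H:
  assumes g: "g \<in> carrier PGL2"
  shows "PM g ** transpose H = (if g \<in> PSL2 then transpose H else H) ** PM g"
  using paley_Pi_H[OF g]
  by (auto simp: transpose_paley_H matrix_diff_ldistrib matrix_diff_rdistrib cscale_mult_left cscale_mult_right)

lemma paley_H_commute: "transpose H ** H = H ** transpose H"
  by (simp add: transpose_paley_H matrix_diff_ldistrib matrix_diff_rdistrib cscale_mult_left cscale_mult_right)

text \<open>
  The involution fixing two distinct points commutes with \<open>H ** transpose H\<close> up to opposite signs
  at these points, which forces the entry of \<open>H ** transpose H\<close> there to vanish.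
\<close>

lemma paley_H_orthogonal:
  assumes "P \<noteq> Q"
  shows "(H ** transpose H) $ P $ Q = 0"
proof -
  define u w where "u = rep P" and "w = rep Q"
  define d where "d = cross2 u w"
  \<comment> \<open>The matrix with columns \<open>u\<close> and \<open>w\<close>, times the
    diagonal matrix with entries 1 and -1, times the adjugate of the first: eigenvalues
    \<open>d\<close> on \<open>u\<close> and \<open>- d\<close> on \<open>w\<close>, without
    division.\<close>
  define A where "A = mat22 (w $ 2 * u $ 1 + u $ 2 * w $ 1) (- 2 * u $ 1 * w $ 1)
    (2 * u $ 2 * w $ 2) (- (w $ 1 * u $ 2 + u $ 1 * w $ 2))"
  have d: "d \<noteq> 0" using assms by (simp add: d_def u_def w_def cross2_rep_eq_0_iff)
  have Au: "A *v u = d *s u" and Aw: "A *v w = (- d) *s w"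
    by (simp_all add: A_def d_def cross2_def vec2_eq_iff matrix_vmult_nth_2 algebra_simps)
  have "det A = - (d\<^sup>2)"
    by (simp add: A_def d_def cross2_def det_2 power2_eq_square algebra_simps)
  then have det: "det A \<noteq> 0" "quad_char (det A) = -1"
    using d chi_minus[of "d\<^sup>2"] by (auto simp: quad_char_square)
  define g where "g = pclass A"
  have g: "g \<in> carrier PGL2" using det by (simp add: g_def pclass_carrier)
  have "g \<notin> PSL2" using det pclass_in_PSL2[of A] by (simp add: g_def)
  have "lift g \<in> pclass A" using valid_lifts g by (simp add: valid_lifts_def g_def)
  then obtain s where s: "s \<noteq> 0" "lift g = mat s ** A" by (auto simp: pclass_iff)
  have fix_P: "pgl_act g P = P"
    using pgl_act_pclass[OF det(1), of u] d pt_eq_iff_scale[of "d *s u" u] Au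
    by (auto simp: g_def u_def)
  have fix_Q: "pgl_act g Q = Q"
    using pgl_act_pclass[OF det(1), of w] d pt_eq_iff_scale[of "(- d) *s w" w] Aw
    by (auto simp: g_def w_def intro!: exI[of _ "- d"])
  have vm: "(mat s ** A) *v x = s *s (A *v x)" for x
    by (simp add: matrix_vector_mul_assoc[symmetric])
  \<comment> \<open>The opposite eigenvalues make the scaling factors at \<open>P\<close> and
    \<open>Q\<close> opposite, and so also their characters.\<close>
  have "(scl g P * s * d) *s u = 1 *s u"
    using scl[OF g, of P] unfolding fix_P s(2) vm u_def[symmetric] Au by (simp add: mult.assoc)
  then have scl_P: "scl g P * (s * d) = 1" 
    by (metis mult.assoc rep_nonzero u_def vec.scale_cancel_right)
  have "(- (scl g Q * s * d)) *s w = 1 *s w"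
    using scl[OF g, of Q] unfolding fix_Q s(2) vm w_def[symmetric] Aw by (simp add: mult.assoc)
  then have "- (scl g Q * (s * d)) = 1" 
    by (metis mult.assoc rep_nonzero w_def vec.scale_cancel_right)
  then have "- scl g Q * (s * d) = scl g P * (s * d)" using scl_P by simp
  then have "- scl g Q = scl g P" using s d by (simp only: mult_cancel_right) auto
  then have "scl g Q = - scl g P" by (metis minus_minus)
  then have chi: "quad_char (scl g Q) = - quad_char (scl g P)"
    using chi_minus scl_nonzero[OF g] by simp
  \<comment> \<open>Being outside \<open>PSL2\<close>, \<open>g\<close> exchanges \<open>H\<close>
    with its transpose; their product is preserved because the two commute.\<close>
  let ?K = "H ** transpose H"
  have "PM g ** ?K = transpose H ** (PM g ** transpose H)"
    using paley_Pi_H[OF g] \<open>g \<notin> PSL2\<close> by (simp add: matrix_mul_assoc)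
  also have "\<dots> = ?K ** PM g"
    using paley_Pi_transpose_H[OF g] \<open>g \<notin> PSL2\<close> paley_H_commute by (simp add: matrix_mul_assoc)
  finally have "(PM g ** ?K) $ P $ Q = (?K ** PM g) $ P $ Q" by simp
  moreover have "(PM g ** ?K) $ P $ Q = quad_char (scl g P) * ?K $ P $ Q"
    using monomial_mat_mult_nth[OF bij_is_inj[OF bij_pgl_act[OF g]], of _ ?K P Q]
    by (simp add: paley_Pi_monomial fix_P)
  moreover have "(?K ** PM g) $ P $ Q = ?K $ P $ Q * quad_char (scl g Q)"
    by (simp add: paley_Pi_monomial mult_monomial_mat_nth fix_Q)
  ultimately show ?thesis by (simp add: chi)
qed

lemma paley_H_mult_transpose: "H ** transpose H = cscale (of_nat (CARD('a) + 1)) (mat 1)"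
proof -
  have "(H ** transpose H) $ P $ P = of_nat (CARD('a) + 1)" for P
    by (simp add: matrix_matrix_mult_def paley_H_nth card_proj_line)
  then show ?thesis using paley_H_orthogonal by (auto simp: matrix_eq_iff mat_def)
qed

section \<open>The cocycle of the monomial representation\<close>

lemma lift_mult:
  assumes g: "g \<in> carrier PGL2" and h: "h \<in> carrier PGL2"
  shows "\<exists>c. c \<noteq> 0 \<and> lift g ** lift h = mat c ** lift (g \<otimes>\<^bsub>PGL2\<^esub> h)"
proof -
  have gh: "g \<otimes>\<^bsub>PGL2\<^esub> h \<in> carrier PGL2"
    using g h by (rule PGL2_mult_closed)
  have "pclass (lift g ** lift h) = g \<otimes>\<^bsub>PGL2\<^esub> h"
    using pclass_mult[OF det_lift[OF g] det_lift[OF h]] pclass_lift[OF g] pclass_lift[OF h] by simp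
  also have "\<dots> = pclass (lift (g \<otimes>\<^bsub>PGL2\<^esub> h))" by (simp add: pclass_lift[OF gh])
  finally show ?thesis by (simp add: pclass_eq_iff)
qed

text \<open>Moving \<open>rep P\<close> by \<open>h\<close> and then by \<open>g\<close> picks up
  two scaling factors, while the lift of the product picks up one, and the lifts differ by
  \<open>c\<close>. The resulting sign does not depend on \<open>P\<close>, so the matrices form a
  projective representation.\<close>

lemma paley_Pi_mult:
  assumes g: "g \<in> carrier PGL2" and h: "h \<in> carrier PGL2" and "c \<noteq> 0"
    and c: "lift g ** lift h = mat c ** lift (g \<otimes>\<^bsub>PGL2\<^esub> h)"
  shows "PM g ** PM h = cscale (quad_char c) (PM (g \<otimes>\<^bsub>PGL2\<^esub> h))"
proof -
  let ?k = "g \<otimes>\<^bsub>PGL2\<^esub> h"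
  have k: "?k \<in> carrier PGL2"
    using g h by (rule PGL2_mult_closed)
  have chi: "quad_char (scl g (pgl_act h P)) * quad_char (scl h P) = quad_char c * quad_char (scl ?k P)" for P
  proof -
    have "(scl g (pgl_act h P) * scl h P) *s ((lift g ** lift h) *v rep P) = rep (pgl_act ?k P)"
      using scl[OF g, of "pgl_act h P"] scl[OF h, of P, symmetric]
      by (simp add: pgl_act_mult[OF g h] matrix_vector_mul_assoc[symmetric] vec.scale)
    also have "\<dots> = scl ?k P *s (lift ?k *v rep P)" by (simp add: scl[OF k])
    also have "(lift g ** lift h) *v rep P = c *s (lift ?k *v rep P)"
      by (simp add: c matrix_vector_mul_assoc[symmetric])
    finally have "scl g (pgl_act h P) * scl h P * c = scl ?k P"
      using lift_vmult_nonzero[OF k, of P] by (simp add: vec.scale_cancel_right)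
    then have "quad_char (scl g (pgl_act h P)) * quad_char (scl h P) * quad_char c = quad_char (scl ?k P)"
      using chi_mult scl_nonzero g h \<open>c \<noteq> 0\<close> by (metis mult_eq_0_iff)
    then show ?thesis by (metis mult.assoc mult.commute mult.right_neutral quad_char_sq)
  qed
  show ?thesis
    unfolding paley_Pi_monomial monomial_mat_mult chi
    by (simp add: matrix_eq_iff monomial_mat_nth pgl_act_mult[OF g h])
qed

lemma PSL2_mult_iff:
  fixes g h :: "('a ^ 2 ^ 2) set"
  assumes g: "g \<in> carrier PGL2" and h: "h \<in> carrier PGL2"
  shows "g \<otimes>\<^bsub>PGL2\<^esub> h \<in> PSL2 \<longleftrightarrow> (g \<in> PSL2 \<longleftrightarrow> h \<in> PSL2)"
proof -
  have "g \<otimes>\<^bsub>PGL2\<^esub> h = pclass (lift g ** lift h)"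
    using pclass_mult[OF det_lift[OF g] det_lift[OF h]] pclass_lift[OF g] pclass_lift[OF h] by simp
  moreover have "det (lift g ** lift h) \<noteq> 0" using det_lift g h by (simp add: det_mul)
  ultimately have "g \<otimes>\<^bsub>PGL2\<^esub> h \<in> PSL2 \<longleftrightarrow> quad_char (det (lift g ** lift h)) = 1"
    using pclass_in_PSL2 by metis
  then show ?thesis
    using PSL2_iff_lift[OF g] PSL2_iff_lift[OF h] chi_mult[OF det_lift[OF g] det_lift[OF h]]
      quad_char_cases[of "det (lift g)"] quad_char_cases[of "det (lift h)"]
    by (auto simp: det_mul)
qed

lemma paley_DPi_mult:
  assumes g: "g \<in> carrier PGL2" and h: "h \<in> carrier PGL2"
  shows "\<exists>c. cmod c = 1 \<and> DPM (g \<otimes>\<^bsub>PGL2\<^esub> h) = cscale c (DPM g ** DPM h)"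
proof -
  obtain c where c: "c \<noteq> 0" "lift g ** lift h = mat c ** lift (g \<otimes>\<^bsub>PGL2\<^esub> h)"
    using lift_mult[OF g h] by blast
  have PM: "PM (g \<otimes>\<^bsub>PGL2\<^esub> h) = cscale (quad_char c) (PM g ** PM h)"
    by (simp add: paley_Pi_mult[OF g h c])
  \<comment> \<open>Two antidiagonal block matrices multiply to a diagonal one with an extra minus
    sign; the other combinations of shapes produce none.\<close>
  define s where "s = (if g \<notin> PSL2 \<and> h \<notin> PSL2 then -1 else 1 :: complex)"
  have "DPM (g \<otimes>\<^bsub>PGL2\<^esub> h) = cscale (s * quad_char c) (DPM g ** DPM h)"
    unfolding paley_DPi_def Let_def PSL2_mult_iff[OF g h] PM
    by (auto simp: s_def block_mat_mult cscale_block_mat matrix_minus_left matrix_minus_right matrix_sum_eq_iff)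
  moreover have "cmod (s * quad_char c) = 1" by (simp add: s_def norm_mult)
  ultimately show ?thesis by blast
qed

lemma unitary_paley_DPi:
  assumes "g \<in> carrier PGL2"
  shows "unitary (DPM g)"
  using unitary_paley_Pi[OF assms] unfolding paley_DPi_def Let_def unitary_def
  by (auto simp: block_mat_mult adj_block_mat matrix_minus_left matrix_minus_right mat_1_block_mat)

lemma projective_paley_DPi: "projective_unitary_rep PGL2 DPM"
  unfolding projective_unitary_rep_def using unitary_paley_DPi paley_DPi_mult by blast

lemma paley_DPi_DH_commute:
  assumes g: "g \<in> carrier PGL2"
  shows "DPM g ** paley_DH rep = paley_DH rep ** DPM g"
  using paley_Pi_H[OF g] paley_Pi_transpose_H[OF g]
  by (auto simp: paley_DPi_def paley_DH_def Let_def block_mat_mult matrix_minus_left matrix_minus_right)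

lemma paley_DPi_automorphism:
  assumes g: "g \<in> carrier PGL2"
  shows "DPM g ** paley_DH rep ** adj (DPM g) = paley_DH rep"
  using unitary_paley_DPi[OF g] unfolding paley_DPi_DH_commute[OF g] unitary_def
  by (metis matrix_mul_assoc matrix_mul_rid)

text \<open>The scalar -1 between the two products is lost in \<open>PGL2\<close> but enters the
  cocycle through its character, which is -1. Membership in \<open>PSL2\<close> makes both block
  matrices diagonal and reduces the claim to \<open>PM\<close>.\<close>

lemma paley_DPi_anticommute:
  assumes "det A \<noteq> 0" "det B \<noteq> 0" "A ** B = mat (-1) ** (B ** A)"
    and "pclass A \<in> PSL2" "pclass B \<in> PSL2"
  shows "pclass A \<otimes>\<^bsub>PGL2\<^esub> pclass B = pclass B \<otimes>\<^bsub>PGL2\<^esub> pclass A"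
    and "DPM (pclass A) ** DPM (pclass B) = - (DPM (pclass B) ** DPM (pclass A))"
proof -
  let ?g = "pclass A" and ?h = "pclass B"
  have g: "?g \<in> carrier PGL2" and h: "?h \<in> carrier PGL2" using assms by (auto simp: pclass_carrier)
  show comm: "?g \<otimes>\<^bsub>PGL2\<^esub> ?h = ?h \<otimes>\<^bsub>PGL2\<^esub> ?g"
    using assms(1-3) by (simp add: pclass_mult) (auto simp: pclass_eq_iff intro!: exI[of _ "-1"])
  obtain c where c: "c \<noteq> 0" "lift ?g ** lift ?h = mat c ** lift (?g \<otimes>\<^bsub>PGL2\<^esub> ?h)"
    using lift_mult[OF g h] by blast
  have "lift ?g \<in> ?g" "lift ?h \<in> ?h" using valid_lifts g h by (auto simp: valid_lifts_def)
  then obtain s t where st: "lift ?g = mat s ** A" "lift ?h = mat t ** B" by (auto simp: pclass_iff)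
  have "A $ i $ 1 * B $ 1 $ j + A $ i $ 2 * B $ 2 $ j = - (B $ i $ 1 * A $ 1 $ j + B $ i $ 2 * A $ 2 $ j)" for i j
  proof -
    have "(A ** B) $ i $ j = (mat (-1) ** (B ** A)) $ i $ j" by (simp only: assms(3))
    then show ?thesis unfolding mat_mult_nth unfolding matrix_mult_nth_2 by simp
  qed note AB = this
  \<comment> \<open>The lifts are scalar multiples of \<open>A\<close> and \<open>B\<close>, so they
    anticommute too, and the cocycle scalars for the two orders are \<open>c\<close> and
    \<open>- c\<close>.\<close>
  have "(lift ?h ** lift ?g) $ i $ j = - (lift ?g ** lift ?h) $ i $ j" for i j
  proof -
    have "(lift ?h ** lift ?g) $ i $ j = s * t * (B $ i $ 1 * A $ 1 $ j + B $ i $ 2 * A $ 2 $ j)"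
      unfolding st by (subst matrix_mult_nth_2) (simp add: algebra_simps)
    moreover have "(lift ?g ** lift ?h) $ i $ j = s * t * (A $ i $ 1 * B $ 1 $ j + A $ i $ 2 * B $ 2 $ j)"
      unfolding st by (subst matrix_mult_nth_2) (simp add: algebra_simps)
    ultimately show ?thesis by (simp only: AB mult_minus_right minus_minus)
  qed
  then have c': "lift ?h ** lift ?g = mat (- c) ** lift (?h \<otimes>\<^bsub>PGL2\<^esub> ?g)"
    by (simp add: vec_eq_iff c(2) comm)
  have "PM ?g ** PM ?h = - (PM ?h ** PM ?g)"
    using paley_Pi_mult[OF g h c] paley_Pi_mult[OF h g _ c'] c(1)
    by (simp add: comm chi_minus matrix_eq_iff)
  then show "DPM ?g ** DPM ?h = - (DPM ?h ** DPM ?g)"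
    using assms by (simp add: paley_DPi_def Let_def block_mat_mult block_mat_uminus)
qed

text \<open>The column to which \<open>DPM g\<close> carries the column \<open>Inl P\<close>, up to
  sign. Only the first copy is followed, since the base column lies there.\<close>

definition double_act :: "('a ^ 2 ^ 2) set \<Rightarrow> 'a proj_line \<Rightarrow> 'a proj_line + 'a proj_line" where
  "double_act g P = (if g \<in> PSL2 then Inl (pgl_act g P) else Inr (pgl_act g P))"

lemma paley_DPi_nth_Inl:
  "DPM g $ i $ Inl P = (if i = double_act g P then quad_char (scl g P) else 0)"
  by (cases i) (auto simp: paley_DPi_def double_act_def Let_def paley_Pi_def)

end

section \<open>The dihedral subgroup\<close>

text \<open>Matrix form of \<open>x + y sqrt (-1)\<close>: products agree with those in
  \<open>adjoin_sqrt_minus_one\<close>, and the determinant is the norm.\<close>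

definition conf :: "'a \<Rightarrow> 'a \<Rightarrow> 'a::field ^ 2 ^ 2" where
  "conf x y = mat22 x y (- y) x"

lemma conf_nth [simp]:
  "conf x y $ 1 $ 1 = x" "conf x y $ 1 $ 2 = y" "conf x y $ 2 $ 1 = - y" "conf x y $ 2 $ 2 = x"
  by (simp_all add: conf_def)

text \<open>The norm form is anisotropic: a nontrivial zero would make \<open>x / y\<close> a square
  root of -1.\<close>

lemma sum_squares_eq_0:
  fixes x y :: "'a::{field,finite}"
  assumes "CARD('a) mod 4 = 3"
  shows "x\<^sup>2 + y\<^sup>2 = 0 \<longleftrightarrow> x = 0 \<and> y = 0"
proof
  assume *: "x\<^sup>2 + y\<^sup>2 = 0"
  have "y = 0"
  proof (rule ccontr)
    assume "y \<noteq> 0"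
    moreover have "x\<^sup>2 = - (y\<^sup>2)" using * by (simp add: eq_neg_iff_add_eq_0)
    ultimately have "(x / y)\<^sup>2 = -1" by (simp add: power_divide)
    then show False using minus_one_neq_square[OF assms] by blast
  qed
  with * show "x = 0 \<and> y = 0" by simp
qed simp

lemma det_conf: "det (conf x y) = x\<^sup>2 + y\<^sup>2"
  by (simp add: det_2 power2_eq_square)

lemma conf_mult: "conf x y ** conf u v = conf (x * u - y * v) (x * v + y * u)"
  by (simp add: matrix_eq_2 matrix_mult_nth_2 algebra_simps)

text \<open>Inverses are conjugates divided by the norm, and the norm is multiplicative. The group
  serves as the domain of the homomorphism that carries the generator \<open>(a, b)\<close> into
  \<open>PGL2\<close>.\<close>

lemma group_mult_of_adjoin_sqrt_minus_one:
  assumes "CARD('a::{field,finite}) mod 4 = 3"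
  shows "group (mult_of (adjoin_sqrt_minus_one :: ('a \<times> 'a) ring))"
proof (rule groupI)
  fix z assume z: "z \<in> carrier (mult_of (adjoin_sqrt_minus_one :: ('a \<times> 'a) ring))"
  obtain x y where xy: "z = (x, y)" by (cases z)
  define n where "n = x\<^sup>2 + y\<^sup>2"
  have n: "n \<noteq> 0"
    using z sum_squares_eq_0[OF assms, of x y] by (auto simp: xy n_def adjoin_sqrt_minus_one_def)
  have "x * x / n + y * y / n = 1"
    using n by (simp add: add_divide_distrib[symmetric] n_def power2_eq_square[symmetric])
  then show "\<exists>w\<in>carrier (mult_of (adjoin_sqrt_minus_one :: ('a \<times> 'a) ring)).
      w \<otimes>\<^bsub>mult_of adjoin_sqrt_minus_one\<^esub> z = \<one>\<^bsub>mult_of adjoin_sqrt_minus_one\<^esub>"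
    using n z by (intro bexI[of _ "(x / n, - y / n)"])
      (auto simp: xy adjoin_sqrt_minus_one_def mult.commute)
next
  fix z w
  assume "z \<in> carrier (mult_of (adjoin_sqrt_minus_one :: ('a \<times> 'a) ring))"
    and "w \<in> carrier (mult_of (adjoin_sqrt_minus_one :: ('a \<times> 'a) ring))"
  moreover obtain x y u v where zw: "z = (x, y)" "w = (u, v)" by (cases z, cases w)
  ultimately have "x\<^sup>2 + y\<^sup>2 \<noteq> 0" "u\<^sup>2 + v\<^sup>2 \<noteq> 0"
    using sum_squares_eq_0[OF assms] by (auto simp: adjoin_sqrt_minus_one_def)
  moreover have "(x * u - y * v)\<^sup>2 + (x * v + y * u)\<^sup>2 = (x\<^sup>2 + y\<^sup>2) * (u\<^sup>2 + v\<^sup>2)"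
    by (simp add: power2_eq_square algebra_simps)
  ultimately have "(x * u - y * v)\<^sup>2 + (x * v + y * u)\<^sup>2 \<noteq> 0" by simp
  then show "z \<otimes>\<^bsub>mult_of adjoin_sqrt_minus_one\<^esub> w
      \<in> carrier (mult_of (adjoin_sqrt_minus_one :: ('a \<times> 'a) ring))"
    by (auto simp: zw adjoin_sqrt_minus_one_def)
qed (auto simp: adjoin_sqrt_minus_one_def algebra_simps)

locale paley_dihedral = paley rep lift
  for rep :: "'a::{field,finite} proj_line \<Rightarrow> 'a ^ 2"
    and lift :: "('a ^ 2 ^ 2) set \<Rightarrow> 'a ^ 2 ^ 2" +
  fixes a b \<alpha> \<beta> :: 'a
  assumes generator: "generate (mult_of adjoin_sqrt_minus_one) {(a, b)}
      = carrier (mult_of (adjoin_sqrt_minus_one :: ('a \<times> 'a) ring))"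
    and \<alpha>\<beta>: "\<alpha>\<^sup>2 + \<beta>\<^sup>2 = -1"
begin

abbreviation "T \<equiv> mat22 \<alpha> \<beta> \<beta> (- \<alpha>)"
abbreviation rotations :: "('a ^ 2 ^ 2) set set" where
  "rotations \<equiv> {pclass (conf x y) | x y. (x, y) \<noteq> (0, 0)}"
abbreviation "\<Delta> \<equiv> Delta_group a b \<alpha> \<beta>"

lemmas norm_eq_0 = sum_squares_eq_0[OF card_mod_4]

lemma det_conf_nonzero: "(x, y) \<noteq> (0, 0) \<Longrightarrow> det (conf x y :: 'a ^ 2 ^ 2) \<noteq> 0"
  by (auto simp: det_conf norm_eq_0)

text \<open>The condition on \<alpha> and \<beta> thus puts the class of \<open>T\<close> into
  \<open>PSL2\<close>, as \<open>paley_DPi_anticommute\<close> asks.\<close>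

lemma det_T: "det T = 1"
proof -
  have "det T = - (\<alpha>\<^sup>2 + \<beta>\<^sup>2)" by (simp add: det_2 power2_eq_square)
  then show ?thesis by (simp add: \<alpha>\<beta>)
qed

lemma rotations_carrier: "rotations \<subseteq> carrier PGL2"
  using det_conf_nonzero pclass_carrier by blast

text \<open>\<open>conf\<close> followed by \<open>pclass\<close> is a homomorphism, and
  homomorphisms carry generated subgroups to generated subgroups.\<close>

lemma generate_rotation: "generate PGL2 {pclass (conf a b)} = rotations"
proof -
  let ?K = "mult_of (adjoin_sqrt_minus_one :: ('a \<times> 'a) ring)"
  let ?f = "\<lambda>(x, y). pclass (conf x y) :: ('a ^ 2 ^ 2) set"
  have K: "carrier ?K = - {(0, 0)}" by (auto simp: adjoin_sqrt_minus_one_def)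
  have grp: "group ?K" by (rule group_mult_of_adjoin_sqrt_minus_one[OF card_mod_4])
  have "?f \<in> hom ?K PGL2"
  proof (rule homI)
    fix z w assume "z \<in> carrier ?K" "w \<in> carrier ?K"
    moreover obtain x y u v where "z = (x, y)" "w = (u, v)" by (cases z, cases w)
    ultimately show "?f (z \<otimes>\<^bsub>?K\<^esub> w) = ?f z \<otimes>\<^bsub>PGL2\<^esub> ?f w"
      using pclass_mult[OF det_conf_nonzero det_conf_nonzero, of x y u v] unfolding K
      by (simp add: conf_mult adjoin_sqrt_minus_one_def)
  next
    fix z assume "z \<in> carrier ?K"
    then show "?f z \<in> carrier PGL2"
      unfolding K by (cases z) (simp add: pclass_carrier det_conf_nonzero)
  qed
  then interpret f: group_hom ?K PGL2 ?f
    by (intro group_hom.intro group_hom_axioms.intro grp group_PGL2)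
  \<comment> \<open>The generator hypothesis itself shows that \<open>(a, b)\<close> is nonzero: the
    pair lies in the set it generates, which is the set of nonzero elements.\<close>
  have "(a, b) \<in> generate ?K {(a, b)}" by (auto intro: generate.incl)
  then have "(a, b) \<in> carrier ?K" by (simp only: generator)
  then have "generate PGL2 (?f ` {(a, b)}) = ?f ` generate ?K {(a, b)}"
    by (intro f.generate_img) auto
  also have "\<dots> = rotations" unfolding generator K by (auto simp: image_iff)
  finally show ?thesis by simp
qed

abbreviation "base \<equiv> pt (axis 1 1 :: 'a ^ 2)"

lemma vmult_base: "(A :: 'a ^ 2 ^ 2) *v axis 1 1 = vector [A $ 1 $ 1, A $ 2 $ 1]"
  by (simp add: vec2_eq_iff matrix_vmult_nth_2 axis_def)

lemma act_base: "det A \<noteq> 0 \<Longrightarrow> pgl_act (pclass A) base = pt (vector [A $ 1 $ 1, A $ 2 $ 1])"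
  by (simp add: pgl_act_pclass vmult_base)

lemma pt_eq_iff_vector:
  "(x, y) \<noteq> (0, 0) \<Longrightarrow> (u, v) \<noteq> (0, 0) \<Longrightarrow>
    pt (vector [x, y] :: 'a ^ 2) = pt (vector [u, v]) \<longleftrightarrow> (\<exists>c. c \<noteq> 0 \<and> x = c * u \<and> y = c * v)"
  by (subst pt_eq_iff_scale) (auto simp: vec2_eq_iff)

lemma conf_eq_scale: "x = c * u \<Longrightarrow> y = c * v \<Longrightarrow> conf x y = mat c ** conf u v"
  by (simp add: matrix_eq_2)

text \<open>The first column of \<open>conf x y\<close> determines the whole matrix, so proportional
  images of the base vector give equal classes; every nonzero column occurs.\<close>

lemma bij_rotations: "bij_betw (\<lambda>g. pgl_act g base) rotations UNIV"
proof (rule bij_betw_imageI)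
  show "inj_on (\<lambda>g. pgl_act g base) rotations"
  proof (rule inj_onI)
    fix g h assume "g \<in> rotations" "h \<in> rotations" and eq: "pgl_act g base = pgl_act h base"
    then obtain x y u v where gh: "g = pclass (conf x y)" "h = pclass (conf u v)"
      and nz: "(x, y) \<noteq> (0, 0)" "(u, v) \<noteq> (0, 0)" by blast
    then have "pt (vector [x, - y]) = pt (vector [u, - v])"
      using eq by (simp add: act_base det_conf norm_eq_0)
    then obtain c where "c \<noteq> 0" "x = c * u" "- y = c * - v"
      using pt_eq_iff_vector[of x "- y" u "- v"] nz by auto
    then show "g = h"
      unfolding gh pclass_eq_iff using conf_eq_scale[of x c u y v] by auto
  qed
  show "(\<lambda>g. pgl_act g base) ` rotations = UNIV"
  proof (intro equalityI subsetI UNIV_I)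
    fix P :: "'a proj_line"
    obtain x where x: "x \<noteq> 0" "P = pt x" by (rule pt_cases)
    then have nz: "(x $ 1, - x $ 2) \<noteq> (0, 0)" by (auto simp: vec2_eq_iff)
    have "vector [x $ 1, x $ 2] = x" by (simp add: vec2_eq_iff)
    then have "P = pgl_act (pclass (conf (x $ 1) (- x $ 2))) base"
      using x nz by (simp add: act_base det_conf norm_eq_0)
    then show "P \<in> (\<lambda>g. pgl_act g base) ` rotations" using nz by blast
  qed
qed

text \<open>The order is the size of the generated subgroup, which \<open>bij_rotations\<close>
  counts by the points of the projective line.\<close>

lemma ord_rotation: "group.ord PGL2 (pclass (conf a b)) = CARD('a) + 1"
proof -
  interpret PGL: group "PGL2 :: ('a ^ 2 ^ 2) set monoid" by (rule group_PGL2)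
  have "pclass (conf a b) \<in> rotations"
    unfolding generate_rotation[symmetric] by (auto intro: generate.incl)
  then have "pclass (conf a b) \<in> carrier PGL2" using rotations_carrier by blast
  then have "PGL.ord (pclass (conf a b)) = card rotations"
    by (simp add: PGL.generate_pow_card generate_rotation)
  also have "\<dots> = CARD('a) + 1"
    using bij_betw_same_card[OF bij_rotations] by (simp add: card_proj_line)
  finally show ?thesis .
qed

lemma T_squared: "T ** T = mat (-1)"
  using \<alpha>\<beta> by (simp add: matrix_eq_2 matrix_mult_nth_2 power2_eq_square add.commute)

lemma T_conf: "T ** conf x y = conf x (- y) ** T"
  by (simp add: matrix_eq_2 matrix_mult_nth_2 algebra_simps)

text \<open>In a multiple of \<open>conf x y\<close> the diagonal entries agree and the other two
  are opposite; in \<open>T\<close> it is the other way round. As 2 is nonzero, only the zero matrix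
  has both patterns.\<close>

lemma T_notin_rotations: "pclass T \<notin> rotations"
proof
  assume "pclass T \<in> rotations"
  then obtain x y where "pclass T = pclass (conf x y)" by blast
  then obtain c where c: "T = mat c ** conf x y" by (auto simp: pclass_eq_iff)
  have "T $ i $ j = (mat c ** conf x y) $ i $ j" for i j by (simp only: c)
  from this[of 1 1] this[of 1 2] this[of 2 1] this[of 2 2]
  have "\<alpha> = - \<alpha>" "\<beta> = - \<beta>" by (simp_all add: minus_equation_iff)
  moreover have "(2::'a) \<noteq> 0"
    using one_neq_minus_one[OF card_mod_4] by (metis eq_neg_iff_add_eq_0 one_add_one)
  ultimately have "\<alpha> = 0" "\<beta> = 0" by (auto simp: eq_neg_iff_add_eq_0 mult_2[symmetric])
  then show False using \<alpha>\<beta> by simp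
qed

text \<open>Moving \<open>T\<close> past \<open>conf a b\<close> conjugates
  \<open>a + b sqrt (-1)\<close>, and the conjugate is the inverse up to the norm; \<open>T\<close>
  squared is the scalar -1. So the dihedral relations hold modulo scalars.\<close>

lemma
  shows Delta_iso: "\<Delta> \<cong> dihedral_group (CARD('a) + 1)"
    and carrier_Delta: "carrier \<Delta> = rotations \<union> (\<lambda>g. g \<otimes>\<^bsub>PGL2\<^esub> pclass T) ` rotations"
proof -
  interpret PGL: group "PGL2 :: ('a ^ 2 ^ 2) set monoid" by (rule group_PGL2)
  have m_rot: "pclass (conf a b) \<in> rotations"
    unfolding generate_rotation[symmetric] by (auto intro: generate.incl)
  then have m: "pclass (conf a b) \<in> carrier PGL2" using rotations_carrier by blast
  have t: "pclass T \<in> carrier PGL2" by (simp add: pclass_carrier det_T)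
  have tt: "pclass T \<otimes>\<^bsub>PGL2\<^esub> pclass T = \<one>\<^bsub>PGL2\<^esub>"
    by (simp add: pclass_mult det_T T_squared one_PGL2 pclass_eq_iff)
      (rule exI[of _ "-1"], simp add: matrix_eq_2)
  have nz: "a\<^sup>2 + b\<^sup>2 \<noteq> 0"
  proof
    assume "a\<^sup>2 + b\<^sup>2 = 0"
    then have ab: "a = 0" "b = 0" by (simp_all add: norm_eq_0)
    have "(a, b) \<in> generate (mult_of (adjoin_sqrt_minus_one :: ('a \<times> 'a) ring)) {(a, b)}"
      by (auto intro: generate.incl)
    then show False unfolding generator by (simp add: ab adjoin_sqrt_minus_one_def)
  qed
  have "pclass (conf a (- b)) \<otimes>\<^bsub>PGL2\<^esub> pclass (conf a b) = \<one>\<^bsub>PGL2\<^esub>"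
    using nz by (simp add: pclass_mult det_conf one_PGL2 conf_mult pclass_eq_iff)
      (rule exI[of _ "a\<^sup>2 + b\<^sup>2"], simp add: matrix_eq_2 power2_eq_square)
  then have inv_m: "inv\<^bsub>PGL2\<^esub> pclass (conf a b) = pclass (conf a (- b))"
    using m nz by (intro PGL.inv_equality) (auto simp: pclass_carrier det_conf)
  have tm: "pclass T \<otimes>\<^bsub>PGL2\<^esub> pclass (conf a b) = inv\<^bsub>PGL2\<^esub> pclass (conf a b) \<otimes>\<^bsub>PGL2\<^esub> pclass T"
    using nz by (simp add: inv_m pclass_mult det_conf det_T T_conf)
  note dih = PGL.dihedral_generate[OF m t ord_rotation _ tt tm, unfolded generate_rotation]
  show "\<Delta> \<cong> dihedral_group (CARD('a) + 1)"
    using dih(2) T_notin_rotations by (simp add: Delta_group_def conf_def)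
  show "carrier \<Delta> = rotations \<union> (\<lambda>g. g \<otimes>\<^bsub>PGL2\<^esub> pclass T) ` rotations"
    using dih(1) T_notin_rotations by (simp add: Delta_group_def conf_def)
qed

lemma mult_Delta [simp]: "monoid.mult \<Delta> = monoid.mult PGL2"
  by (simp add: Delta_group_def)

lemma carrier_Delta_subset: "carrier \<Delta> \<subseteq> carrier PGL2"
proof -
  have "pclass T \<in> carrier PGL2" by (simp add: pclass_carrier det_T)
  then show ?thesis unfolding carrier_Delta using rotations_carrier PGL2_mult_closed by blast
qed

lemma Delta_cases:
  assumes "g \<in> carrier \<Delta>"
  obtains (rot) x y where "(x, y) \<noteq> (0, 0)" "g = pclass (conf x y)"
  | (refl) x y where "(x, y) \<noteq> (0, 0)" "g = pclass (conf x y ** T)"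
proof -
  consider x y where "(x, y) \<noteq> (0, 0)" "g = pclass (conf x y)"
    | x y where "(x, y) \<noteq> (0, 0)" "g = pclass (conf x y) \<otimes>\<^bsub>PGL2\<^esub> pclass T"
    using assms unfolding carrier_Delta by blast
  then show ?thesis
  proof cases
    case 1
    then show ?thesis by (rule rot)
  next
    case 2
    then show ?thesis using refl[OF 2(1)] by (simp add: pclass_mult det_conf_nonzero det_T)
  qed
qed

lemma order_Delta: "order \<Delta> = 2 * (CARD('a) + 1)"
proof -
  obtain f where "f \<in> iso \<Delta> (dihedral_group (CARD('a) + 1))" using Delta_iso by (auto simp: is_iso_def)
  then have "bij_betw f (carrier \<Delta>) (carrier (dihedral_group (CARD('a) + 1)))" by (simp add: iso_def)
  then show ?thesis using bij_betw_same_card order_dihedral_group unfolding order_def by metis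
qed

section \<open>Simple transitivity of Delta on the columns\<close>

lemma det_conf_T: "det (conf x y ** T) = x\<^sup>2 + y\<^sup>2"
  by (simp add: det_mul det_conf det_T)

text \<open>
  If a rotation and a reflection agree on the base point, then their determinants differ by a factor
  \<open>- c\<^sup>2\<close>, so exactly one of them lies in \<open>PSL2\<close>.
\<close>

lemma double_act_rot_neq_refl:
  assumes nz: "(x, y) \<noteq> (0, 0)" "(u, v) \<noteq> (0, 0)"
  shows "double_act (pclass (conf x y)) base \<noteq> double_act (pclass (conf u v ** T)) base"
proof
  let ?g = "pclass (conf x y)" and ?h = "pclass (conf u v ** T)"
  assume eq: "double_act ?g base = double_act ?h base"
  have det: "det (conf x y) \<noteq> 0" "det (conf u v ** T) \<noteq> 0"
    using nz by (simp_all add: det_conf det_conf_T norm_eq_0)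
  \<comment> \<open>\<open>(r, s)\<close> is the first column of \<open>conf u v ** T\<close>, the
    image of the base vector; its norm is that of \<open>(u, v)\<close> times -1.\<close>
  define r s where "r = u * \<alpha> + v * \<beta>" and "s = - v * \<alpha> + u * \<beta>"
  have "r\<^sup>2 + s\<^sup>2 = (u\<^sup>2 + v\<^sup>2) * (\<alpha>\<^sup>2 + \<beta>\<^sup>2)"
    by (simp add: r_def s_def power2_eq_square algebra_simps)
  then have rs: "r\<^sup>2 + s\<^sup>2 = - (u\<^sup>2 + v\<^sup>2)" by (simp add: \<alpha>\<beta>)
  have "(r, s) \<noteq> (0, 0)"
  proof
    assume "(r, s) = (0, 0)"
    then have "- (u\<^sup>2 + v\<^sup>2) = 0" unfolding rs[symmetric] by simp
    then have "u\<^sup>2 + v\<^sup>2 = 0" by (simp only: neg_equal_0_iff_equal)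
    then show False using nz by (simp add: norm_eq_0)
  qed
  moreover have "pt (vector [x, - y]) = pt (vector [r, s])"
    using eq act_base[OF det(1)] act_base[OF det(2)]
    by (simp add: double_act_def r_def s_def matrix_mult_nth_2 split: if_splits)
  ultimately obtain c where c: "c \<noteq> 0" "x = c * r" "- y = c * s"
    using pt_eq_iff_vector[of x "- y" r s] nz by auto
  have "x\<^sup>2 + y\<^sup>2 = (c * r)\<^sup>2 + (c * s)\<^sup>2" using c by (metis power2_minus)
  also have "\<dots> = c\<^sup>2 * (r\<^sup>2 + s\<^sup>2)" by (simp add: power_mult_distrib algebra_simps)
  also have "\<dots> = - (c\<^sup>2 * (u\<^sup>2 + v\<^sup>2))" by (simp add: rs algebra_simps)
  finally have "quad_char (x\<^sup>2 + y\<^sup>2) = - quad_char (u\<^sup>2 + v\<^sup>2)"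
    using c(1) nz norm_eq_0[of u v]
    by (simp add: chi_minus quad_char_square_times del: minus_add_distrib mult_minus_right)
  moreover have "?g \<in> PSL2 \<longleftrightarrow> ?h \<in> PSL2"
    using eq by (auto simp: double_act_def split: if_splits)
  ultimately show False
    using pclass_in_PSL2[OF det(1)] pclass_in_PSL2[OF det(2)] quad_char_cases[of "u\<^sup>2 + v\<^sup>2"]
    by (auto simp: det_conf det_conf_T)
qed

text \<open>The base point separates two rotations. A rotation and a reflection with the same image
  point land in different copies. Two reflections become two rotations applied to the first column
  of \<open>T\<close>.\<close>

lemma inj_double_act: "inj_on (\<lambda>g. double_act g base) (carrier \<Delta>)"
proof (rule inj_onI)
  fix g h assume g: "g \<in> carrier \<Delta>" and h: "h \<in> carrier \<Delta>"
    and eq: "double_act g base = double_act h base"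
  have act: "pgl_act g base = pgl_act h base"
    using eq by (auto simp: double_act_def split: if_splits)
  show "g = h"
    using g
  proof (cases rule: Delta_cases)
    case g: (rot x y)
    show ?thesis using h
    proof (cases rule: Delta_cases)
      case (rot u v)
      then show ?thesis
        using g act inj_onD[OF bij_betw_imp_inj_on[OF bij_rotations], of g h] by blast
    next
      case (refl u v)
      then show ?thesis using g eq double_act_rot_neq_refl by metis
    qed
  next
    case g: (refl x y)
    show ?thesis using h
    proof (cases rule: Delta_cases)
      case (rot u v)
      then show ?thesis using g eq double_act_rot_neq_refl by metis
    next
      case h: (refl u v)
      define w :: "'a ^ 2" where "w = vector [\<alpha>, \<beta>]"
      have "\<alpha> \<noteq> 0 \<or> \<beta> \<noteq> 0" using \<alpha>\<beta> by auto
      then have w: "w \<noteq> 0" by (auto simp: w_def vec2_eq_iff)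
      have dets: "det (conf x y ** T) \<noteq> 0" "det (conf u v ** T) \<noteq> 0"
        "det (conf x y) \<noteq> 0" "det (conf u v) \<noteq> 0"
        using g h by (simp_all add: det_conf det_conf_T norm_eq_0)
      have "pgl_act (pclass (conf x y ** T)) base = pt (conf x y *v w)"
        using act_base[OF dets(1)] 
        by (simp add: w_def vec2_eq_iff matrix_vmult_nth_2 matrix_mult_nth_2 arg_cong[of _ _ pt])
      moreover have "pgl_act (pclass (conf u v ** T)) base = pt (conf u v *v w)"
        using act_base[OF dets(2)] 
        by (simp add: w_def vec2_eq_iff matrix_vmult_nth_2 matrix_mult_nth_2 arg_cong[of _ _ pt])
      ultimately have "pt (conf x y *v w) = pt (conf u v *v w)" using act g h by simp
      then obtain c where c: "c \<noteq> 0" "conf x y *v w = c *s (conf u v *v w)"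
        using pt_eq_iff_scale vmult_eq_0_iff dets w by metis
      \<comment> \<open>The matrices \<open>conf\<close> are closed under linear combinations and
        invertible unless zero, so one that kills the nonzero \<open>w\<close> is zero.\<close>
      have "conf (x - c * u) (y - c * v) *v w = 0"
        using c(2) by (simp add: vec2_eq_iff matrix_vmult_nth_2 algebra_simps)
      then have "det (conf (x - c * u) (y - c * v)) = 0" using vmult_eq_0_iff w by blast
      then have "x = c * u" "y = c * v" by (auto simp: det_conf norm_eq_0)
      then have "conf x y ** T = mat c ** (conf u v ** T)"
        by (simp only: conf_eq_scale matrix_mul_assoc)
      then show ?thesis using g h c(1) by (auto simp: pclass_eq_iff)
    qed
  qed
qed

lemma bij_double_act: "bij_betw (\<lambda>g. double_act g base) (carrier \<Delta>) UNIV"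
proof -
  have "card ((\<lambda>g. double_act g base) ` carrier \<Delta>) = 2 * (CARD('a) + 1)"
    using card_image[OF inj_double_act] order_Delta by (simp add: order_def)
  also have "\<dots> = CARD('a proj_line + 'a proj_line)"
    by (simp add: card_proj_line)
  finally have "(\<lambda>g. double_act g base) ` carrier \<Delta> = UNIV"
    by (intro card_subset_eq) auto
  then show ?thesis using inj_double_act by (simp add: bij_betw_def)
qed

lemma projective_Delta: "projective_unitary_rep \<Delta> DPM"
  using projective_paley_DPi carrier_Delta_subset unfolding projective_unitary_rep_def mult_Delta by blast

text \<open>The central rotation of order two and the reflection commute in \<open>PGL2\<close>, but their lifts anticommute.\<close>

lemma Delta_anticommute:
  obtains z t where "z \<in> carrier \<Delta>" "t \<in> carrier \<Delta>" "z \<otimes>\<^bsub>\<Delta>\<^esub> t = t \<otimes>\<^bsub>\<Delta>\<^esub> z"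
    "DPM z ** DPM t = - (DPM t ** DPM z)"
proof
  \<comment> \<open>\<open>conf 0 1\<close> stands for \<open>sqrt (-1)\<close>; its square is the
    scalar -1, so its class has order two.\<close>
  have det: "det (conf 0 (1::'a)) = 1" by (simp add: det_conf)
  have rot: "pclass (conf 0 1) \<in> rotations" "pclass (conf 1 0) \<in> rotations"
    by (rule CollectI, rule exI[of _ 0], rule exI[of _ 1], simp)
      (rule CollectI, rule exI[of _ 1], rule exI[of _ 0], simp)
  show "pclass (conf 0 1) \<in> carrier \<Delta>" using rot by (simp add: carrier_Delta)
  have "conf 1 0 = (mat 1 :: 'a ^ 2 ^ 2)" by (simp add: matrix_eq_2)
  then have "pclass T = pclass (conf 1 0) \<otimes>\<^bsub>PGL2\<^esub> pclass T"
    by (simp add: pclass_mult det_T)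
  then show "pclass T \<in> carrier \<Delta>" using rot by (auto simp: carrier_Delta)
  have anti: "conf 0 1 ** T = mat (-1) ** (T ** conf 0 1)"
    by (simp add: matrix_eq_2 matrix_mult_nth_2)
  have one: "quad_char (1::'a) = 1" using quad_char_square[of 1] by simp
  have PSL: "pclass (conf 0 (1::'a)) \<in> PSL2" "pclass T \<in> PSL2"
    using pclass_in_PSL2[of "conf 0 (1::'a)"] pclass_in_PSL2[of T] by (simp_all add: det det_T one)
  show "pclass (conf 0 1) \<otimes>\<^bsub>\<Delta>\<^esub> pclass T = pclass T \<otimes>\<^bsub>\<Delta>\<^esub> pclass (conf 0 1)"
    and "DPM (pclass (conf 0 1)) ** DPM (pclass T) = - (DPM (pclass T) ** DPM (pclass (conf 0 1)))"
    using paley_DPi_anticommute[OF _ _ anti PSL] by (simp_all add: det det_T)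
qed

lemma genuine_Delta: "genuine_rep \<Delta> DPM"
  using Delta_anticommute genuine_rep_if_anticommute[OF projective_Delta] by metis

end

section \<open>Tight frames with a prescribed Gram matrix\<close>

lemma trace_mult_adj: "trace (B ** adj B) = of_real (\<Sum>i\<in>UNIV. \<Sum>j\<in>UNIV. (cmod (B $ i $ j))\<^sup>2)"
  by (simp add: trace_def matrix_matrix_mult_def complex_norm_square[symmetric])

lemma trace_mult_adj_eq_0:
  assumes "trace (B ** adj B) = 0"
  shows "B = 0"
proof -
  have "(\<Sum>i\<in>UNIV. \<Sum>j\<in>UNIV. (cmod (B $ i $ j))\<^sup>2) = 0"
    using assms unfolding trace_mult_adj of_real_eq_0_iff .
  then show ?thesis by (simp add: sum_nonneg_eq_0_iff sum_nonneg matrix_eq_iff)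
qed

lemma trace_cscale: "trace (cscale c A) = c * trace A"
  by (simp add: trace_def sum_distrib_left)

text \<open>
  The squared Frobenius norm of \<open>2 - \<Psi> \<Psi>\<^sup>*\<close> is \<open>4 d - 2 n\<close>, because the traces of \<open>\<Psi> \<Psi>\<^sup>*\<close> and of its
  square are those of the Gram matrix \<open>K\<close> and of \<open>K\<^sup>2 = 2 K\<close>.
\<close>

lemma tight_frame_if_gram:
  fixes \<Psi> :: "complex ^ 'n ^ 'd"
  assumes K: "adj \<Psi> ** \<Psi> = K" "K ** K = cscale 2 K" "\<And>i. K $ i $ i = 1"
    and card: "CARD('n) = 2 * CARD('d)"
  shows "\<Psi> ** adj \<Psi> = cscale 2 (mat 1)"
proof -
  let ?A = "\<Psi> ** adj \<Psi>"
  have trK: "trace K = of_nat CARD('n)" by (simp add: trace_def K(3))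
  have trA: "trace ?A = of_nat CARD('n)" by (subst trace_mul_sym) (simp add: K(1) trK)
  have "trace (?A ** ?A) = trace (\<Psi> ** (adj \<Psi> ** \<Psi> ** adj \<Psi>))" by (simp add: matrix_mul_assoc)
  also have "\<dots> = trace (adj \<Psi> ** \<Psi> ** (adj \<Psi> ** \<Psi>))"
    by (subst trace_mul_sym) (simp add: matrix_mul_assoc)
  finally have trAA: "trace (?A ** ?A) = 2 * of_nat CARD('n)"
    by (simp add: K trace_cscale trK)
  let ?B = "cscale 2 (mat 1) - ?A"
  have "adj ?B = ?B" by (simp add: adj_diff adj_mult)
  then have "?B ** adj ?B = cscale 4 (mat 1) - cscale 4 ?A + ?A ** ?A"
    by (simp add: matrix_diff_ldistrib matrix_diff_rdistrib cscale_mult_left cscale_mult_right)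
      (simp add: matrix_eq_iff)
  then have "trace (?B ** adj ?B) = 0"
    by (simp add: trace_add trace_sub trace_cscale trA trAA trace_I card)
  then show ?thesis using trace_mult_adj_eq_0 by fastforce
qed

lemma norm_column_eq_1:
  assumes "(adj \<Psi> ** \<Psi>) $ j $ j = 1"
  shows "norm (column j \<Psi>) = 1"
proof -
  have "(\<Sum>k\<in>UNIV. cnj (\<Psi> $ k $ j) * \<Psi> $ k $ j) = 1"
    using assms by (simp add: matrix_matrix_mult_def)
  also have "(\<Sum>k\<in>UNIV. cnj (\<Psi> $ k $ j) * \<Psi> $ k $ j) = of_real (\<Sum>k\<in>UNIV. (cmod (\<Psi> $ k $ j))\<^sup>2)"
    by (simp only: of_real_sum complex_norm_square mult.commute)
  finally have "(\<Sum>k\<in>UNIV. (cmod (\<Psi> $ k $ j))\<^sup>2) = 1" by (simp only: of_real_eq_1_iff)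
  then show ?thesis by (simp add: norm_vec_def L2_set_def column_def)
qed

text \<open>The factor \<open>1 / 2\<close> is the inverse of the frame bound.\<close>

definition compress :: "complex ^ 'n ^ 'd \<Rightarrow> complex ^ 'n ^ 'n \<Rightarrow> complex ^ 'd ^ 'd" where
  "compress \<Psi> M = cscale (1 / 2) (\<Psi> ** M ** adj \<Psi>)"

context
  fixes \<Psi> :: "complex ^ 'n ^ 'd"
  assumes tight: "\<Psi> ** adj \<Psi> = cscale 2 (mat 1)"
begin

text \<open>\<open>M\<close> slides past the Gram matrix, which leaves the frame operator in front;
  its value 2 cancels the factor in \<open>compress\<close>.\<close>

lemma compress_intertwine:
  assumes "M ** (adj \<Psi> ** \<Psi>) = (adj \<Psi> ** \<Psi>) ** M"
  shows "compress \<Psi> M ** \<Psi> = \<Psi> ** M"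
proof -
  have "\<Psi> ** M ** adj \<Psi> ** \<Psi> = \<Psi> ** (M ** (adj \<Psi> ** \<Psi>))" by (simp add: matrix_mul_assoc)
  also have "\<dots> = \<Psi> ** ((adj \<Psi> ** \<Psi>) ** M)" by (simp only: assms)
  also have "\<dots> = (\<Psi> ** adj \<Psi>) ** (\<Psi> ** M)" by (simp add: matrix_mul_assoc)
  finally show ?thesis by (simp add: compress_def cscale_mult_left tight)
qed

lemma compress_mult:
  assumes "M ** (adj \<Psi> ** \<Psi>) = (adj \<Psi> ** \<Psi>) ** M"
  shows "compress \<Psi> M ** compress \<Psi> N = compress \<Psi> (M ** N)"
proof -
  have "compress \<Psi> M ** compress \<Psi> N = cscale (1 / 2) (compress \<Psi> M ** \<Psi> ** N ** adj \<Psi>)"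
    by (simp add: compress_def[of \<Psi> N] cscale_mult_right matrix_mul_assoc)
  also have "\<dots> = compress \<Psi> (M ** N)"
    unfolding compress_intertwine[OF assms] by (simp add: compress_def matrix_mul_assoc)
  finally show ?thesis .
qed

lemma compress_1: "compress \<Psi> (mat 1) = mat 1"
  by (simp add: compress_def tight)

lemma unitary_compress:
  assumes "unitary M" "M ** (adj \<Psi> ** \<Psi>) = (adj \<Psi> ** \<Psi>) ** M"
  shows "unitary (compress \<Psi> M)"
proof -
  have "adj (compress \<Psi> M) = compress \<Psi> (adj M)"
    by (simp add: compress_def adj_mult matrix_mul_assoc)
  then have "compress \<Psi> M ** adj (compress \<Psi> M) = mat 1"
    using assms compress_mult[of M "adj M"] compress_1 by (simp add: unitary_def)
  then show ?thesis unfolding unitary_def using matrix_left_right_inverse by blast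
qed

lemma projective_compress:
  assumes \<Gamma>: "projective_unitary_rep G \<Gamma>"
    and comm: "\<And>g. g \<in> carrier G \<Longrightarrow> \<Gamma> g ** (adj \<Psi> ** \<Psi>) = (adj \<Psi> ** \<Psi>) ** \<Gamma> g"
  shows "projective_unitary_rep G (\<lambda>g. compress \<Psi> (\<Gamma> g))"
  unfolding projective_unitary_rep_def
proof (intro conjI ballI)
  fix g assume "g \<in> carrier G"
  then show "unitary (compress \<Psi> (\<Gamma> g))"
    using \<Gamma> comm by (auto simp: projective_unitary_rep_def intro: unitary_compress)
next
  fix g h assume g: "g \<in> carrier G" and h: "h \<in> carrier G"
  then obtain c where c: "cmod c = 1" "\<Gamma> (g \<otimes>\<^bsub>G\<^esub> h) = cscale c (\<Gamma> g ** \<Gamma> h)"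
    using \<Gamma> unfolding projective_unitary_rep_def by blast
  have "compress \<Psi> (\<Gamma> (g \<otimes>\<^bsub>G\<^esub> h)) = cscale c (compress \<Psi> (\<Gamma> g) ** compress \<Psi> (\<Gamma> h))"
    unfolding compress_mult[OF comm[OF g]]
    by (simp add: c(2) compress_def cscale_mult_left cscale_mult_right)
  then show "\<exists>c. cmod c = 1 \<and> compress \<Psi> (\<Gamma> (g \<otimes>\<^bsub>G\<^esub> h)) = cscale c (compress \<Psi> (\<Gamma> g) ** compress \<Psi> (\<Gamma> h))"
    using c(1) by blast
qed

end

lemma compress_uminus: "compress \<Psi> (- M) = - compress \<Psi> M"
  by (simp add: compress_def matrix_minus_left matrix_minus_right) (simp add: matrix_eq_iff)

section \<open>The double Paley frame\<close>

lemma phase_monomial_id: "(\<And>j. cmod (c j) = 1) \<Longrightarrow> phase_monomial (monomial_mat id c)"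
  unfolding phase_monomial_def monomial_mat_def by (intro exI[of _ id] exI[of _ c]) auto

lemma adj_monomial_id: "adj (monomial_mat id c) = monomial_mat id (\<lambda>j. cnj (c j))"
  by (auto simp: matrix_eq_iff monomial_mat_nth)

context paley
begin

text \<open>The skew condition, substituted into the Hadamard condition, gives a quadratic equation
  for \<open>H\<close>; the same holds for its transpose.\<close>

lemma paley_H_square: "H ** H = cscale 2 H - cscale (of_nat (CARD('a) + 1)) (mat 1)"
  "transpose H ** transpose H = cscale 2 (transpose H) - cscale (of_nat (CARD('a) + 1)) (mat 1)"
proof -
  have H: "H = cscale 2 (mat 1) - transpose H" by (simp add: transpose_paley_H)
  have "H ** H = H ** (cscale 2 (mat 1) - transpose H)" by (rule arg_cong[OF H])
  then show "H ** H = cscale 2 H - cscale (of_nat (CARD('a) + 1)) (mat 1)"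
    by (simp add: matrix_diff_ldistrib cscale_mult_right paley_H_mult_transpose)
  have "transpose H ** transpose H = (cscale 2 (mat 1) - H) ** transpose H"
    by (simp add: transpose_paley_H)
  then show "transpose H ** transpose H = cscale 2 (transpose H) - cscale (of_nat (CARD('a) + 1)) (mat 1)"
    by (simp add: matrix_diff_rdistrib cscale_mult_left paley_H_mult_transpose)
qed

abbreviation "DH \<equiv> paley_DH rep"

lemma paley_DH_block: "DH = block_mat H H (- transpose H) (transpose H)"
  by (simp add: paley_DH_def Let_def)

lemma paley_DH_square: "DH ** DH = cscale 2 DH - cscale (2 * of_nat (CARD('a) + 1)) (mat 1)"
proof -
  have "transpose H ** H = cscale (of_nat (CARD('a) + 1)) (mat 1)"
    by (simp add: paley_H_commute paley_H_mult_transpose)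
  then show ?thesis
    unfolding paley_DH_block block_mat_mult mat_1_block_mat cscale_block_mat block_mat_diff
    by (simp add: matrix_minus_left matrix_minus_right paley_H_mult_transpose paley_H_square)
      (simp add: matrix_sum_eq_iff)
qed

text \<open>Here \<open>2 q + 1\<close> is one less than the order of the double Paley matrix, as in
  \<open>skew_hadamard_gram\<close>.\<close>

definition \<kappa> :: complex where
  "\<kappa> = 1 / complex_of_real (sqrt (2 * real CARD('a) + 1))"

lemma kappa_square: "\<kappa> * \<kappa> * (2 * of_nat CARD('a) + 1) = 1"
proof -
  have "complex_of_real (sqrt (2 * real CARD('a) + 1)) * complex_of_real (sqrt (2 * real CARD('a) + 1))
    = 2 * of_nat CARD('a) + 1"
    unfolding of_real_mult[symmetric] by simp
  moreover have "2 * of_nat CARD('a) + (1::complex) \<noteq> 0"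
    using of_nat_neq_0[of "2 * CARD('a)", where 'a = complex] by (simp add: add.commute)
  ultimately show ?thesis by (simp add: \<kappa>_def)
qed

lemma skew_hadamard_gram_DH:
  "skew_hadamard_gram DH = cscale (1 - \<i> * \<kappa>) (mat 1) + cscale (\<i> * \<kappa>) DH"
proof -
  have "skew_hadamard_gram DH = mat 1 + cscale (\<i> * \<kappa>) (DH - mat 1)"
    by (simp add: skew_hadamard_gram_def card_proj_line \<kappa>_def add.commute)
  then show ?thesis by (simp add: matrix_eq_iff algebra_simps)
qed

text \<open>\<open>DH - mat 1\<close> squares to the scalar \<open>- (2 q + 1)\<close>, so
  \<open>\<i> * \<kappa>\<close> times it is an involution, and the identity plus an involution
  squares to twice itself.\<close>

lemma gram_square: "skew_hadamard_gram DH ** skew_hadamard_gram DH = cscale 2 (skew_hadamard_gram DH)"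
proof -
  let ?k = "\<i> * \<kappa>" and ?q = "of_nat CARD('a) :: complex"
  have k: "?k * ?k * (2 * ?q + 1) = -1"
    using kappa_square by (simp add: algebra_simps)
  have "skew_hadamard_gram DH ** skew_hadamard_gram DH
    = cscale ((1 - ?k) * (1 - ?k)) (mat 1) + cscale (2 * ?k * (1 - ?k)) DH + cscale (?k * ?k) (DH ** DH)"
    unfolding skew_hadamard_gram_DH
    by (simp add: matrix_add_ldistrib matrix_add_rdistrib cscale_mult_left cscale_mult_right)
      (simp add: matrix_eq_iff algebra_simps)
  also have "\<dots> = cscale ((1 - ?k) * (1 - ?k) - ?k * ?k * (2 * (?q + 1))) (mat 1) + cscale (2 * ?k) DH"
    unfolding paley_DH_square by (simp add: matrix_eq_iff algebra_simps)
  also have "(1 - ?k) * (1 - ?k) - ?k * ?k * (2 * (?q + 1)) = 2 * (1 - ?k)"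
  proof -
    have "(1 - ?k) * (1 - ?k) - ?k * ?k * (2 * (?q + 1)) = 1 - 2 * ?k - ?k * ?k * (2 * ?q + 1)"
      by (simp add: algebra_simps)
    then show ?thesis unfolding k by simp
  qed
  finally show ?thesis unfolding skew_hadamard_gram_DH by (simp add: cscale_add mult.assoc)
qed

lemma gram_diag: "skew_hadamard_gram DH $ i $ i = 1"
  unfolding skew_hadamard_gram_DH by (cases i) (simp_all add: paley_DH_block mat_def)

lemma gram_commute:
  assumes "g \<in> carrier PGL2"
  shows "DPM g ** skew_hadamard_gram DH = skew_hadamard_gram DH ** DPM g"
  unfolding skew_hadamard_gram_DH
  by (simp add: matrix_add_ldistrib matrix_add_rdistrib cscale_mult_left cscale_mult_right
      paley_DPi_DH_commute[OF assms])

section \<open>The Gram matrix of the double Paley ETF and its switching\<close>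

definition double_gram :: "complex ^ ('a proj_line + 'a proj_line) ^ ('a proj_line + 'a proj_line)" where
  "double_gram = block_mat (mat 1 + cscale (\<i> * \<kappa>) (H - mat 1)) (cscale \<kappa> H)
     (cscale \<kappa> (transpose H)) (mat 1 + cscale (\<i> * \<kappa>) (transpose H - mat 1))"

lemma double_paley_ETF_iff: "double_paley_ETF rep \<Phi> \<longleftrightarrow> adj \<Phi> ** \<Phi> = double_gram"
proof -
  have "mat 1 + cscale \<kappa> (block_mat (cscale \<i> (H - mat 1)) H
      (transpose H) (cscale \<i> (transpose H - mat 1))) = double_gram"
    unfolding double_gram_def mat_1_block_mat cscale_block_mat block_mat_add
    by (simp add: mult.commute)
  then show ?thesis by (simp add: double_paley_ETF_def Let_def \<kappa>_def)
qed

text \<open>The value on the second copy turns the off-diagonal blocks, real multiples of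
  \<open>H\<close> and its transpose, into \<open>\<i>\<close> times \<open>H\<close> and
  \<open>- \<i>\<close> times the transpose, as \<open>DH\<close> demands.\<close>

definition phase :: "'a proj_line + 'a proj_line \<Rightarrow> complex" where
  "phase j = (case j of Inl _ \<Rightarrow> 1 | Inr _ \<Rightarrow> - \<i>)"

lemma cmod_phase [simp]: "cmod (phase j) = 1"
  by (simp add: phase_def split: sum.split)

lemma unitary_phase: "unitary (monomial_mat id phase)"
  by (rule unitary_monomial_mat) auto

lemma gram_phase: "monomial_mat id phase ** double_gram ** adj (monomial_mat id phase) = skew_hadamard_gram DH"
proof -
  have "(monomial_mat id phase ** double_gram ** adj (monomial_mat id phase)) $ i $ j
    = phase i * double_gram $ i $ j * cnj (phase j)" for i j
    using monomial_mat_mult_nth[of id phase double_gram i j]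
    by (simp add: adj_monomial_id mult_monomial_mat_nth)
  then show ?thesis
    unfolding matrix_sum_eq_iff skew_hadamard_gram_DH
    by (simp add: phase_def double_gram_def paley_DH_block mat_def algebra_simps)
qed

lemma double_gram_diag: "double_gram $ i $ i = 1"
  by (cases i) (simp_all add: double_gram_def mat_def)

lemma cmod_paley_H [simp]: "cmod (H $ P $ Q) = 1"
  by (simp add: paley_H_nth)

lemma cmod_double_gram: "i \<noteq> j \<Longrightarrow> cmod (double_gram $ i $ j) = cmod \<kappa>"
  by (cases i; cases j) (simp_all add: double_gram_def mat_def norm_mult)

text \<open>The trace argument applies to \<open>\<Psi>\<close>, whose Gram matrix is a polynomial
  in \<open>DH\<close>. The phases are unitary, so \<open>\<Phi>\<close> has the same frame
  operator.\<close>

lemma double_paley_tight: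
  fixes \<Phi> :: "complex ^ ('a proj_line + 'a proj_line) ^ 'd"
  assumes \<Phi>: "double_paley_ETF rep \<Phi>" and d: "CARD('d) = CARD('a) + 1"
  defines "\<Psi> \<equiv> \<Phi> ** adj (monomial_mat id phase)"
  shows "adj \<Psi> ** \<Psi> = skew_hadamard_gram DH" and "\<Psi> ** adj \<Psi> = cscale 2 (mat 1)"
    and "\<Phi> ** adj \<Phi> = cscale 2 (mat 1)"
proof -
  show gram: "adj \<Psi> ** \<Psi> = skew_hadamard_gram DH"
    using \<Phi> gram_phase unfolding double_paley_ETF_iff
    by (simp add: \<Psi>_def adj_mult matrix_mul_assoc) (metis matrix_mul_assoc)
  show tight: "\<Psi> ** adj \<Psi> = cscale 2 (mat 1)"
    by (rule tight_frame_if_gram[OF gram gram_square gram_diag]) (simp add: d card_proj_line)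
  have "\<Psi> ** adj \<Psi> = \<Phi> ** (adj (monomial_mat id phase) ** monomial_mat id phase) ** adj \<Phi>"
    by (simp add: \<Psi>_def adj_mult matrix_mul_assoc)
  also have "\<dots> = \<Phi> ** adj \<Phi>" using unitary_phase by (simp add: unitary_def)
  finally show "\<Phi> ** adj \<Phi> = cscale 2 (mat 1)" using tight by simp
qed

lemma double_paley_is_ETF:
  fixes \<Phi> :: "complex ^ ('a proj_line + 'a proj_line) ^ 'd"
  assumes \<Phi>: "double_paley_ETF rep \<Phi>" and d: "CARD('d) = CARD('a) + 1"
  shows "is_ETF (2 * CARD('a) + 2) (CARD('a) + 1) \<Phi>"
proof -
  have gram: "adj \<Phi> ** \<Phi> = double_gram" using \<Phi> by (simp add: double_paley_ETF_iff)
  have "\<Phi> ** adj \<Phi> = mat (complex_of_real 2)"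
    using double_paley_tight(3)[OF \<Phi> d] by (simp add: matrix_eq_iff mat_def)
  then show ?thesis
    unfolding is_ETF_def using d norm_column_eq_1[of \<Phi>] cmod_double_gram
    by (auto simp: gram card_proj_line double_gram_diag intro!: exI[of _ 2])
qed

text \<open>
  Both blocks of the frame are taken in the commutative algebra spanned by the identity and the skew
  matrix \<open>H - 1\<close>; comparing coefficients with the Gram matrix gives \<open>Y\<close>, \<open>U\<close> and \<open>W\<close> below.
\<close>

lemma ex_double_paley_ETF:
  assumes d: "CARD('d::finite) = CARD('a) + 1"
  shows "\<exists>\<Phi> :: complex ^ ('a proj_line + 'a proj_line) ^ 'd. double_paley_ETF rep \<Phi>"
proof -
  define q where "q = real CARD('a)"
  have "q > 0" by (simp add: q_def)
  define c where "c = 1 / sqrt (2 * q + 1)"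
  \<comment> \<open>The squared modulus of \<open>Y\<close> must be \<open>p = 1 / q\<close> and its
    imaginary part \<open>c\<close>, so its real part is the root of
    \<open>1 / q - 1 / (2 q + 1)\<close>.\<close>
  define r where "r = sqrt ((q + 1) / (q * (2 * q + 1)))"
  define p where "p = 1 / q"
  define k where "k = c / r"
  have cc: "c\<^sup>2 * (2 * q + 1) = 1" using \<open>q > 0\<close> by (simp add: c_def power_divide)
  have rr: "r\<^sup>2 * (q * (2 * q + 1)) = q + 1" using \<open>q > 0\<close> by (simp add: r_def)
  have "r > 0" using \<open>q > 0\<close> by (simp add: r_def)
  have pq: "p * q = 1" using \<open>q > 0\<close> by (simp add: p_def)
  have kr: "k * r = c" using \<open>r > 0\<close> by (simp add: k_def)
  have rc: "q * (r\<^sup>2 + c\<^sup>2) = 1"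
  proof -
    have "q * (r\<^sup>2 + c\<^sup>2) * (2 * q + 1) = r\<^sup>2 * (q * (2 * q + 1)) + q * (c\<^sup>2 * (2 * q + 1))"
      by (simp add: algebra_simps)
    also have "\<dots> = 1 * (2 * q + 1)" unfolding cc rr by simp
    finally have "q * (r\<^sup>2 + c\<^sup>2) * (2 * q + 1) = 1 * (2 * q + 1)" .
    then show ?thesis using \<open>q > 0\<close> by (simp only: mult_cancel_right) auto
  qed
  \<comment> \<open>In the form \<open>k\<^sup>2 * (1 + p) = 1\<close> this is what remains to be
    checked for the second block once \<open>U\<close> and \<open>W\<close> are fixed.\<close>
  have kk: "k\<^sup>2 * (q + 1) = q"
  proof -
    have "(k\<^sup>2 * (q + 1)) * (r\<^sup>2 * (2 * q + 1)) = (k * r)\<^sup>2 * (2 * q + 1) * (q + 1)"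
      by (simp add: power_mult_distrib)
    also have "\<dots> = q * (r\<^sup>2 * (2 * q + 1))" unfolding kr cc using rr by (simp add: mult_ac)
    finally have "(k\<^sup>2 * (q + 1)) * (r\<^sup>2 * (2 * q + 1)) = q * (r\<^sup>2 * (2 * q + 1))" .
    then show ?thesis using \<open>q > 0\<close> \<open>r > 0\<close> by (simp only: mult_cancel_right) auto
  qed
  have rp: "r\<^sup>2 + c\<^sup>2 = p" using rc \<open>q > 0\<close> by (simp add: p_def field_simps)
  have kp: "k\<^sup>2 * (1 + p) = 1"
  proof -
    have "k\<^sup>2 * (1 + p) = k\<^sup>2 * (p * q + p)" by (simp only: pq)
    also have "\<dots> = p * (k\<^sup>2 * (q + 1))" by (simp add: algebra_simps)
    finally show ?thesis by (simp only: kk pq)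
  qed
  define Y where "Y = Complex r c"
  \<comment> \<open>Given \<open>Y\<close>, the equations \<open>e2\<close> and \<open>e3\<close>
    are linear in \<open>U\<close> and \<open>W\<close>. Since \<open>q * Y\<close> is the inverse
    of \<open>cnj Y\<close>, they yield \<open>U = k * (Y - 1)\<close> and
    \<open>W = k * (Y + p)\<close>.\<close>
  define U where "U = Complex (k * (r - 1)) (k * c)"
  define W where "W = Complex (k * (r + p)) (k * c)"
  let ?q = "of_real q :: complex"
  \<comment> \<open>Coefficients of \<open>mat 1\<close> and \<open>H - mat 1\<close>:
    \<open>e1\<close> belongs to \<open>adj A ** A\<close>, \<open>e2\<close> and \<open>e3\<close>
    to \<open>adj A ** B\<close>, \<open>e4\<close> and \<open>e5\<close> to
    \<open>adj B ** B\<close>. The sign in \<open>e5\<close> arises because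
    \<open>transpose H - mat 1\<close> is the negative of \<open>H - mat 1\<close>.\<close>
  have e1: "1 + ?q * (cnj Y * Y) = 2" "Y - cnj Y = 2 * \<i> * of_real c"
    using rc by (simp_all add: complex_eq_iff Y_def power2_eq_square algebra_simps)
  have e2: "U + ?q * (cnj Y * W) = 2 * of_real c"
  proof -
    have "k * (r - 1) + q * (r * (k * (r + p)) + c * (k * c))
        = k * (r - 1) + k * (q * (r\<^sup>2 + c\<^sup>2)) + k * r * (p * q)"
      by (simp add: power2_eq_square algebra_simps)
    also have "\<dots> = 2 * c" unfolding rc pq using kr by (simp add: algebra_simps)
    finally have "k * (r - 1) + q * (r * (k * (r + p)) + c * (k * c)) = 2 * c" .
    moreover have "k * c + q * (r * (k * c) - c * (k * (r + p))) = 0"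
    proof -
      have "k * c + q * (r * (k * c) - c * (k * (r + p))) = k * c - k * c * (p * q)"
        by (simp add: algebra_simps)
      then show ?thesis by (simp add: pq)
    qed
    ultimately show ?thesis by (simp add: complex_eq_iff Y_def U_def W_def)
  qed
  have e3: "W - cnj Y * U = 2 * of_real c"
  proof -
    have "k * (r + p) - (r * (k * (r - 1)) + c * (k * c)) = k * (r + p) + k * r - k * (r\<^sup>2 + c\<^sup>2)"
      by (simp add: power2_eq_square algebra_simps)
    also have "\<dots> = 2 * c" unfolding rp using kr by (simp add: algebra_simps)
    finally have "k * (r + p) - (r * (k * (r - 1)) + c * (k * c)) = 2 * c" .
    moreover have "k * c - (r * (k * c) - c * (k * (r - 1))) = 0" by (simp add: algebra_simps)
    ultimately show ?thesis by (simp add: complex_eq_iff Y_def U_def W_def)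
  qed
  have e4: "cnj U * U + ?q * (cnj W * W) = 2"
  proof -
    have "(k * (r - 1))\<^sup>2 + (k * c)\<^sup>2 + q * ((k * (r + p))\<^sup>2 + (k * c)\<^sup>2) = 2"
    proof -
      have "(k * (r - 1))\<^sup>2 + (k * c)\<^sup>2 + q * ((k * (r + p))\<^sup>2 + (k * c)\<^sup>2)
          = k\<^sup>2 * ((r\<^sup>2 + c\<^sup>2) - 2 * r + 1 + q * (r\<^sup>2 + c\<^sup>2) + 2 * r * (p * q) + p * (p * q))"
        by (simp add: power2_eq_square algebra_simps)
      also have "\<dots> = 2 * (k\<^sup>2 * (1 + p))" unfolding rc pq unfolding rp by (simp add: algebra_simps)
      finally show ?thesis by (simp only: kp)
    qed
    then show ?thesis by (simp add: complex_eq_iff U_def W_def power2_eq_square algebra_simps)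
  qed
  have e5: "cnj U * W - cnj W * U = - 2 * \<i> * of_real c"
  proof -
    have "k * (r - 1) * (k * c) - k * c * (k * (r + p)) = - c"
    proof -
      have "k * (r - 1) * (k * c) - k * c * (k * (r + p)) = - c * (k\<^sup>2 * (1 + p))"
        by (simp add: power2_eq_square algebra_simps)
      then show ?thesis by (simp only: kp)
    qed
    then show ?thesis by (simp add: complex_eq_iff U_def W_def algebra_simps)
  qed
  \<comment> \<open>\<open>H - mat 1\<close> is skew-adjoint with square \<open>- q\<close>, so
    these matrices multiply like numbers \<open>x + y sqrt (-q)\<close>, and the adjoint conjugates
    both the coefficients and the root.\<close>
  define E where "E x y = cscale x (mat 1) + cscale y (H - mat 1)" for x y
  have SS: "(H - mat 1) ** (H - mat 1) = cscale (- ?q) (mat 1)"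
    by (simp add: matrix_diff_ldistrib matrix_diff_rdistrib paley_H_square q_def)
      (simp add: matrix_eq_iff algebra_simps)
  have adjS: "adj (H - mat 1) = cscale (-1) (H - mat 1)"
    by (simp add: adj_diff adj_paley_H transpose_paley_H) (simp add: matrix_eq_iff)
  have EE: "adj (E x y) ** E u w = E (cnj x * u + ?q * (cnj y * w)) (cnj x * w - cnj y * u)" for x y u w
    unfolding E_def adj_add adj_cscale adjS
    by (simp add: matrix_add_ldistrib matrix_add_rdistrib cscale_mult_left cscale_mult_right SS)
      (simp add: matrix_eq_iff algebra_simps)
  define A B where "A = E 1 Y" and "B = E U W"
  have AA: "adj A ** A = cscale 2 (mat 1 + cscale (\<i> * of_real c) (H - mat 1))"
    unfolding A_def EE using e1 by (simp add: E_def cscale_add mult.assoc)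
  have AB: "adj A ** B = cscale 2 (cscale (of_real c) H)"
    unfolding A_def B_def EE using e2 e3 by (simp add: E_def) (simp add: matrix_eq_iff algebra_simps)
  have BB: "adj B ** B = cscale 2 (mat 1 + cscale (\<i> * of_real c) (transpose H - mat 1))"
    unfolding B_def EE using e4 e5
    by (simp add: E_def transpose_paley_H) (simp add: matrix_eq_iff algebra_simps)
  have BA: "adj B ** A = cscale 2 (cscale (of_real c) (transpose H))"
  proof -
    have "adj B ** A = adj (adj A ** B)" by (simp add: adj_mult)
    then show ?thesis by (simp add: AB adj_paley_H)
  qed
  \<comment> \<open>The type \<open>'d\<close> is known only by its cardinality, so its elements are
    matched with points to label the rows.\<close>
  obtain f :: "'d \<Rightarrow> 'a proj_line" where f: "bij f"
    using finite_same_card_bij[of "UNIV :: 'd set" "UNIV :: 'a proj_line set"] d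
    by (auto simp: card_proj_line)
  \<comment> \<open>The factor \<open>1 / sqrt 2\<close> removes the common factor 2 of the four
    block products.\<close>
  define \<Phi> :: "complex ^ ('a proj_line + 'a proj_line) ^ 'd" where
    "\<Phi> = (\<chi> i j. of_real (1 / sqrt 2) * (case j of Inl P \<Rightarrow> A $ f i $ P | Inr P \<Rightarrow> B $ f i $ P))"
  have half: "complex_of_real (1 / sqrt 2) * complex_of_real (1 / sqrt 2) = 1 / 2"
    unfolding of_real_mult[symmetric] by simp
  have reindex: "(\<Sum>i\<in>UNIV. cnj (of_real (1 / sqrt 2) * M $ f i $ P) * (of_real (1 / sqrt 2) * N $ f i $ Q))
    = 1 / 2 * (adj M ** N) $ P $ Q" for M N :: "complex ^ 'a proj_line ^ 'a proj_line" and P Q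
  proof -
    have "(\<Sum>i\<in>UNIV. cnj (of_real (1 / sqrt 2) * M $ f i $ P) * (of_real (1 / sqrt 2) * N $ f i $ Q))
      = (\<Sum>i\<in>UNIV. 1 / 2 * (cnj (M $ f i $ P) * N $ f i $ Q))"
      unfolding half[symmetric] by (simp add: mult_ac)
    also have "\<dots> = (\<Sum>R\<in>UNIV. 1 / 2 * (cnj (M $ R $ P) * N $ R $ Q))"
      using f by (intro sum.reindex_bij_betw)
    also have "\<dots> = 1 / 2 * (adj M ** N) $ P $ Q"
      by (simp add: matrix_matrix_mult_def sum_distrib_left)
    finally show ?thesis .
  qed
  have c: "complex_of_real c = \<kappa>" by (simp add: c_def \<kappa>_def q_def)
  have nth: "\<Phi> $ i $ Inl P = of_real (1 / sqrt 2) * A $ f i $ P"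
    "\<Phi> $ i $ Inr P = of_real (1 / sqrt 2) * B $ f i $ P" for i P
    by (simp_all add: \<Phi>_def)
  have prod: "(adj \<Phi> ** \<Phi>) $ i $ j = (\<Sum>k\<in>UNIV. cnj (\<Phi> $ k $ i) * \<Phi> $ k $ j)" for i j
    by (simp add: matrix_matrix_mult_def)
  have "adj \<Phi> ** \<Phi> = double_gram"
    unfolding matrix_sum_eq_iff prod nth reindex AA AB BA BB c double_gram_def by simp
  then show ?thesis using double_paley_ETF_iff by blast
qed

end

context paley_dihedral
begin

lemma double_paley_frame:
  fixes \<Phi> :: "complex ^ ('a proj_line + 'a proj_line) ^ 'd"
  assumes \<Phi>: "double_paley_ETF rep \<Phi>" and d: "CARD('d) = CARD('a) + 1"
  shows "\<exists>\<pi> v. arises_from_automorphisms \<Delta> DH DPM \<pi> \<Phi>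
    \<and> genuine_projective_dihedral_frame \<Delta> (CARD('a) + 1) \<pi> v \<Phi>"
proof (intro exI conjI)
  define \<Psi> where "\<Psi> = \<Phi> ** adj (monomial_mat id phase)"
  let ?\<pi> = "\<lambda>g. compress \<Psi> (DPM g)" and ?v = "column (Inl base) \<Psi>"
  note tight = double_paley_tight[OF \<Phi> d, folded \<Psi>_def]
  have comm: "DPM g ** (adj \<Psi> ** \<Psi>) = (adj \<Psi> ** \<Psi>) ** DPM g" if "g \<in> carrier \<Delta>" for g
    using that carrier_Delta_subset gram_commute by (auto simp: tight(1))
  have inter: "?\<pi> g ** \<Psi> = \<Psi> ** DPM g" if "g \<in> carrier \<Delta>" for g
    using compress_intertwine[OF tight(2) comm[OF that]] .
  have "unitary (mat 1 :: complex ^ 'd ^ 'd)" by (simp add: unitary_def)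
  then have sw: "switching_equivalent (\<Phi> ** adj (monomial_mat id c)) \<Phi>" if "\<And>j. cmod (c j) = 1" for c
    unfolding switching_equivalent_def using phase_monomial_id[OF that]
    by (intro exI[of _ "mat 1"] exI[of _ "monomial_mat id c"]) simp
  show "arises_from_automorphisms \<Delta> DH DPM ?\<pi> \<Phi>"
    unfolding arises_from_automorphisms_def
    using sw[of phase] tight(1) inter by (auto simp: \<Psi>_def)
  have proj: "projective_unitary_rep \<Delta> ?\<pi>"
    by (rule projective_compress[OF tight(2) projective_Delta comm])
  obtain z t where zt: "z \<in> carrier \<Delta>" "t \<in> carrier \<Delta>" "z \<otimes>\<^bsub>\<Delta>\<^esub> t = t \<otimes>\<^bsub>\<Delta>\<^esub> z"
    "DPM z ** DPM t = - (DPM t ** DPM z)"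
    by (rule Delta_anticommute)
  have "?\<pi> z ** ?\<pi> t = - (?\<pi> t ** ?\<pi> z)"
    by (simp add: compress_mult[OF tight(2) comm] zt compress_uminus)
  then have genuine: "genuine_rep \<Delta> ?\<pi>"
    by (rule genuine_rep_if_anticommute[OF proj zt(1-3)])
  have norm: "norm ?v = 1"
    by (rule norm_column_eq_1) (simp add: tight(1) gram_diag)
  \<comment> \<open>Each column is labelled by the unique group element carrying the base column to
    it.\<close>
  define e where "e = inv_into (carrier \<Delta>) (\<lambda>g. double_act g base)"
  have e: "bij_betw e UNIV (carrier \<Delta>)"
    unfolding e_def by (rule bij_betw_inv_into[OF bij_double_act])
  have act_e: "double_act (e j) base = j" for j
    unfolding e_def using bij_betw_inv_into_right[OF bij_double_act] by simp
  \<comment> \<open>These signs of the monomial matrices remain on the columns; together with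
    \<open>phase\<close> they form the switching.\<close>
  define s where "s j = quad_char (scl (e j) base)" for j
  have "(?\<pi> (e j) *v ?v) $ k = (\<Phi> ** adj (monomial_mat id (\<lambda>j. s j * phase j))) $ k $ j" for k j
  proof -
    have "e j \<in> carrier \<Delta>" using e by (auto simp: bij_betw_def)
    have "(?\<pi> (e j) *v ?v) $ k = (?\<pi> (e j) ** \<Psi>) $ k $ Inl base"
      by (simp add: matrix_vector_mult_def matrix_matrix_mult_def column_def)
    also have "\<dots> = (\<Psi> ** DPM (e j)) $ k $ Inl base"
      by (simp add: inter[OF \<open>e j \<in> carrier \<Delta>\<close>])
    also have "\<dots> = \<Psi> $ k $ j * s j"
      by (simp add: matrix_matrix_mult_def paley_DPi_nth_Inl act_e s_def if_distrib cong: if_cong)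
    also have "\<dots> = (\<Phi> ** adj (monomial_mat id (\<lambda>j. s j * phase j))) $ k $ j"
      by (simp add: \<Psi>_def adj_monomial_id mult_monomial_mat_nth s_def)
    finally show ?thesis .
  qed
  then have "(\<chi> k j. (?\<pi> (e j) *v ?v) $ k) = \<Phi> ** adj (monomial_mat id (\<lambda>j. s j * phase j))"
    by (simp add: matrix_eq_iff)
  then have "generates_frame \<Delta> ?\<pi> ?v \<Phi>"
    unfolding generates_frame_def using e sw[of "\<lambda>j. s j * phase j"]
    by (auto simp: s_def norm_mult intro!: exI[of _ e])
  then show "genuine_projective_dihedral_frame \<Delta> (CARD('a) + 1) ?\<pi> ?v \<Phi>"
    unfolding genuine_projective_dihedral_frame_def using Delta_iso genuine norm by blast
qed

end

text \<open>The Gram matrix fixes the double Paley ETF only up to a unitary, so every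
  \<open>\<Phi>\<close> with that Gram matrix is covered, and a separate clause asserts that one
  exists.\<close>

theorem theorem5p8:
  fixes q :: nat
    and rep :: "'a::{field,finite} proj_line \<Rightarrow> 'a ^ 2"
    and lift :: "('a ^ 2 ^ 2) set \<Rightarrow> 'a ^ 2 ^ 2"
    and a b \<alpha> \<beta> :: 'a
  assumes "CARD('a) = q" and "q mod 4 = 3"
    and "CARD('d::finite) = q + 1"
    and "valid_reps rep" and "valid_lifts lift"
    and "generate (mult_of adjoin_sqrt_minus_one) {(a, b)}
           = carrier (mult_of (adjoin_sqrt_minus_one :: ('a \<times> 'a) ring))"
    and "\<alpha>\<^sup>2 + \<beta>\<^sup>2 = -1"
  shows "Delta_group a b \<alpha> \<beta> \<cong> dihedral_group (q + 1)
    \<and> order (Delta_group a b \<alpha> \<beta>) = 2 * (q + 1)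
    \<and> (\<forall>g\<in>carrier (Delta_group a b \<alpha> \<beta>).
         paley_DPi rep lift g ** paley_DH rep ** adj (paley_DPi rep lift g) = paley_DH rep)
    \<and> genuine_rep (Delta_group a b \<alpha> \<beta>) (paley_DPi rep lift)
    \<and> (\<exists>\<Phi> :: complex ^ ('a proj_line + 'a proj_line) ^ 'd. double_paley_ETF rep \<Phi>)
    \<and> (\<forall>\<Phi> :: complex ^ ('a proj_line + 'a proj_line) ^ 'd. double_paley_ETF rep \<Phi> \<longrightarrow>
         is_ETF (2 * q + 2) (q + 1) \<Phi> \<and>
         (\<exists>\<pi> v. arises_from_automorphisms (Delta_group a b \<alpha> \<beta>) (paley_DH rep)
                  (paley_DPi rep lift) \<pi> \<Phi> \<and>
                genuine_projective_dihedral_frame (Delta_group a b \<alpha> \<beta>) (q + 1) \<pi> v \<Phi>))"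
proof -
  interpret paley_dihedral rep lift a b \<alpha> \<beta>
    by unfold_locales (use assms in auto)
  have q: "q = CARD('a)" and d: "CARD('d) = CARD('a) + 1" using assms by auto
  show ?thesis
    unfolding q
    using Delta_iso order_Delta paley_DPi_automorphism carrier_Delta_subset genuine_Delta
      ex_double_paley_ETF[OF d] double_paley_is_ETF[OF _ d] double_paley_frame[OF _ d]
    by (intro conjI) blast+
qed

end
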